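(* Let $d\in\{2,3\}$. Consider a magnetic field $\mathbf B=\mathrm{curl}\,\mathbf A$ with magnetic potential $\mathbf A\in\mathrm L^2_{\mathrm{loc}}(\mathbb R^d;\mathbb R^d)$ and assume that $\|\nabla_{\mathbf A}\psi\|_2^2\ge\Lambda\|\psi\|_2^2$ for all $\psi\in\mathrm H^1_{\mathbf A}(\mathbb R^d)$ for some $\Lambda=\Lambda[\mathbf B]>0$, with equality for some nonzero $\psi\in\mathrm H^1_{\mathbf A}(\mathbb R^d)$. For any $p\in(2,2^* )$ and any $\alpha>-\Lambda$, let $\mu_{\mathbf B}(\alpha)$ be the largest constant such that $$\|\nabla_{\mathbf A}\psi\|_2^2+\alpha\|\psi\|_2^2\ge\mu_{\mathbf B}(\alpha)\,\|\psi\|_p^2\quad\forall\,\psi\in\mathrm H^1_{\mathbf A}(\mathbb R^d).$$ Then $$\mu_{\mathbf B}(\alpha)\ge\mu_{\mathrm{interp}}(\alpha),$$ where $$\mu_{\mathrm{interp}}(\alpha):=\begin{cases}\mathsf S_p\,(\alpha+\Lambda)\,\Lambda^{-d\frac{p-2}{2p}}&\text{if }\alpha\in\Big[-\Lambda,\frac{\Lambda\,(2p-d(p-2))}{d(p-2)}\Big],\\[4pt]\mathsf C_p\,\alpha^{1-d\frac{p-2}{2p}}&\text{if }\alpha\ge\frac{\Lambda\,(2p-d(p-2))}{d(p-2)}.\end{cases}$$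
   Context: $2^*=+\infty$ if $d=2$ and $2^*=6$ if $d=3$. $\|\cdot\|_q$ is the norm of $\mathrm L^q(\mathbb R^d)$. $\nabla_{\mathbf A}:=\nabla+i\mathbf A$ and $\mathrm H^1_{\mathbf A}(\mathbb R^d):=\{\psi\in\mathrm L^2(\mathbb R^d;\mathbb C):\nabla_{\mathbf A}\psi\in\mathrm L^2(\mathbb R^d)\}$. For $p\in(2,2^* )$, $$\mathsf C_p:=\min_{u\in\mathrm H^1(\mathbb R^d)\setminus\{0\}}\frac{\|\nabla u\|_2^2+\|u\|_2^2}{\|u\|_p^2},\qquad \mathsf S_p:=\frac1{2p}\,\big(2p-d(p-2)\big)^{1-d\frac{p-2}{2p}}\,\big(d(p-2)\big)^{\frac{d(p-2)}{2p}}\,\mathsf C_p .$$ *)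

theory Defs
  imports "HOL-Analysis.Analysis"
begin

section \<open>Lebesgue spaces\<close>

text \<open>The norm is extended-real valued, so that it is infinite, and not a junk value, for a
  function that is not in \<open>L\<^sup>q\<close>. It is meant for measurable functions and finite \<open>q \<ge> 1\<close>.\<close>

definition Lnorm :: "real \<Rightarrow> ('a::euclidean_space \<Rightarrow> 'b::real_normed_vector) \<Rightarrow> ereal" where
  "Lnorm q f = (let I = (\<integral>\<^sup>+ x. ennreal (norm (f x) powr q) \<partial>lebesgue)
                in if I = \<infinity> then \<infinity> else ereal (enn2real I powr (1 / q)))"

definition Lq :: "real \<Rightarrow> ('a::euclidean_space \<Rightarrow> 'b::real_normed_vector) set" where
  "Lq q = {f. f \<in> borel_measurable lebesgue \<and> Lnorm q f < \<infinity>}"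

definition Lq_loc :: "real \<Rightarrow> ('a::euclidean_space \<Rightarrow> 'b::real_normed_vector) set" where
  "Lq_loc q = {f. f \<in> borel_measurable lebesgue \<and>
                  (\<forall>K. compact K \<longrightarrow> (\<lambda>x. indicator K x *\<^sub>R f x) \<in> Lq q)}"

definition ae_zero :: "('a::euclidean_space \<Rightarrow> 'b::zero) \<Rightarrow> bool" where
  "ae_zero f \<longleftrightarrow> (AE x in lebesgue. f x = 0)"

section \<open>Test functions and weak gradients\<close>

primrec Ck :: "nat \<Rightarrow> ('a::euclidean_space \<Rightarrow> real) \<Rightarrow> bool" where
  "Ck 0 f \<longleftrightarrow> continuous_on UNIV f"
| "Ck (Suc k) f \<longleftrightarrow> f differentiable_on UNIV \<and>
                   (\<forall>v. Ck k (\<lambda>x. frechet_derivative f (at x) v))"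

definition test_functions :: "('a::euclidean_space \<Rightarrow> real) set" where
  "test_functions = {\<phi>. (\<forall>k. Ck k \<phi>) \<and> compact (closure {x. \<phi> x \<noteq> 0})}"

text \<open>Real-valued test functions suffice, since both sides are linear in \<open>\<phi>\<close>.\<close>

definition has_weak_grad :: "(real^'n \<Rightarrow> complex) \<Rightarrow> (real^'n \<Rightarrow> complex^'n) \<Rightarrow> bool" where
  "has_weak_grad \<psi> F \<longleftrightarrow> \<psi> \<in> Lq_loc 1 \<and> F \<in> Lq_loc 1 \<and>
     (\<forall>\<phi>\<in>test_functions. \<forall>i.
        (LINT x|lebesgue. frechet_derivative \<phi> (at x) (axis i 1) *\<^sub>R \<psi> x)
          = - (LINT x|lebesgue. \<phi> x *\<^sub>R (F x $ i)))"

section \<open>Magnetic Sobolev spaces\<close>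

text \<open>\<open>G = \<nabla>\<psi> + \<i>A\<psi>\<close> in the sense of distributions. For \<open>A\<close> in \<open>L\<^sup>2\<^sub>l\<^sub>o\<^sub>c\<close> and \<open>\<psi>\<close>, \<open>G\<close> in \<open>L\<^sup>2\<close> the
  function \<open>G - \<i>A\<psi>\<close> is locally integrable, so \<^const>\<open>has_weak_grad\<close> imposes no extra condition.
  The magnetic field \<open>curl A\<close> enters only through the potential \<open>A\<close>.\<close>

definition has_mag_grad ::
  "(real^'n \<Rightarrow> real^'n) \<Rightarrow> (real^'n \<Rightarrow> complex) \<Rightarrow> (real^'n \<Rightarrow> complex^'n) \<Rightarrow> bool" where
  "has_mag_grad A \<psi> G \<longleftrightarrow>
     has_weak_grad \<psi> (\<lambda>x. G x - (\<chi> i. \<i> * complex_of_real (A x $ i) * \<psi> x))"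

text \<open>The magnetic gradient is unique up to null sets, so its norm does not depend on the
  representative chosen here.\<close>

definition mag_grad ::
  "(real^'n \<Rightarrow> real^'n) \<Rightarrow> (real^'n \<Rightarrow> complex) \<Rightarrow> (real^'n \<Rightarrow> complex^'n)" where
  "mag_grad A \<psi> = (SOME G. has_mag_grad A \<psi> G)"

definition H1_mag :: "(real^'n \<Rightarrow> real^'n) \<Rightarrow> (real^'n \<Rightarrow> complex) set" where
  "H1_mag A = {\<psi>. \<psi> \<in> Lq 2 \<and> (\<exists>G. has_mag_grad A \<psi> G \<and> G \<in> Lq 2)}"

abbreviation H1 :: "(real^'n \<Rightarrow> complex) set" where
  "H1 \<equiv> H1_mag (\<lambda>_. 0)"

abbreviation weak_grad :: "(real^'n \<Rightarrow> complex) \<Rightarrow> (real^'n \<Rightarrow> complex^'n)" where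
  "weak_grad \<equiv> mag_grad (\<lambda>_. 0)"

section \<open>The constants\<close>

text \<open>Only the values at \<open>d = 2\<close> and \<open>d = 3\<close> are meaningful.\<close>

definition two_star :: "nat \<Rightarrow> ereal" where
  "two_star d = (if d = 2 then \<infinity> else 6)"

text \<open>The minimum is written as an infimum; that it is attained is not part of the definition.\<close>

definition C_const :: "'n::finite itself \<Rightarrow> real \<Rightarrow> real" where
  "C_const _ p = real_of_ereal
     (INF u \<in> {u \<in> (H1 :: (real^'n \<Rightarrow> complex) set). \<not> ae_zero u}.
        ((Lnorm 2 (weak_grad u))\<^sup>2 + (Lnorm 2 u)\<^sup>2) / (Lnorm p u)\<^sup>2)"

definition S_const :: "'n::finite itself \<Rightarrow> real \<Rightarrow> real" where
  "S_const T p = (let d = real CARD('n) in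
     1 / (2 * p)
     * (2 * p - d * (p - 2)) powr (1 - d * ((p - 2) / (2 * p)))
     * (d * (p - 2)) powr (d * (p - 2) / (2 * p))
     * C_const T p)"

definition mu_mag :: "(real^'n \<Rightarrow> real^'n) \<Rightarrow> real \<Rightarrow> real \<Rightarrow> real" where
  "mu_mag A p \<alpha> = (GREATEST \<mu>. \<forall>\<psi>\<in>H1_mag A.
     (Lnorm 2 (mag_grad A \<psi>))\<^sup>2 + ereal \<alpha> * (Lnorm 2 \<psi>)\<^sup>2 \<ge> ereal \<mu> * (Lnorm p \<psi>)\<^sup>2)"

text \<open>The two formulas agree where the two ranges of \<open>\<alpha>\<close> meet.\<close>

definition mu_interp :: "'n::finite itself \<Rightarrow> real \<Rightarrow> real \<Rightarrow> real \<Rightarrow> real" where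
  "mu_interp T p \<Lambda> \<alpha> = (let d = real CARD('n) in
     if \<alpha> \<le> \<Lambda> * (2 * p - d * (p - 2)) / (d * (p - 2))
     then S_const T p * (\<alpha> + \<Lambda>) * \<Lambda> powr (- (d * ((p - 2) / (2 * p))))
     else C_const T p * \<alpha> powr (1 - d * ((p - 2) / (2 * p))))"

end

theory Submission
  imports Defs "HOL-Computational_Algebra.Polynomial"
begin

text \<open>
  The diamagnetic inequality \<open>\<bar>\<nabla>\<bar>\<psi>\<bar>\<bar> \<le> \<bar>\<nabla>\<^sub>A \<psi>\<bar>\<close> transfers the Gagliardo--Nirenberg inequality, rescaled by
  a dilation, to magnetic fields: with \<open>\<theta> = d (p - 2) / (2 p)\<close>,
  \<open>\<parallel>\<nabla>\<^sub>A \<psi>\<parallel>\<^sup>2 + \<kappa> \<parallel>\<psi>\<parallel>\<^sup>2 \<ge> C\<^sub>p \<kappa> powr (1 - \<theta>) \<parallel>\<psi>\<parallel>\<^sub>p\<^sup>2\<close> for every \<open>\<kappa> > 0\<close>. For large \<open>\<alpha>\<close> one takes \<open>\<kappa> = \<alpha>\<close>;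
  otherwise one takes the convex combination of this inequality with \<open>\<parallel>\<nabla>\<^sub>A \<psi>\<parallel>\<^sup>2 \<ge> \<Lambda> \<parallel>\<psi>\<parallel>\<^sup>2\<close> whose
  \<open>L\<^sup>2\<close> coefficient is \<open>\<alpha>\<close>, the optimal choice being \<open>\<kappa> = \<Lambda> (1 - \<theta>) / \<theta>\<close>.

  The gradient of \<open>\<psi>\<close> itself is only locally integrable, so the derivative of \<open>\<bar>\<psi>\<bar>\<close> is computed by
  difference quotients: those of \<open>\<psi>\<close> converge in \<open>L\<^sup>1\<^sub>l\<^sub>o\<^sub>c\<close> by continuity of translations. The quotients
  are symmetric because then the limit vanishes on \<open>{\<psi> = 0}\<close>, where the one-sided ones give
  \<open>\<plusminus>\<bar>\<nabla>\<psi>\<bar>\<close>.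
\<close>

section \<open>Smooth test functions\<close>

text \<open>The product \<open>A \<psi>\<close> of an \<open>L^2_loc\<close> and an
  \<open>L^2\<close> function is only locally integrable, so \<psi> itself need not lie in
  \<open>H1\<close>. Its modulus does, once the magnetic term has dropped out, and it is the modulus
  that is inserted into the infimum defining \<open>C_const\<close>. The two regimes come from one
  optimisation. Weighting the rescaled inequality by
  \<open>s = (\<alpha> + \<Lambda>) / (\<kappa> + \<Lambda>)\<close> and the spectral one by
  \<open>1 - s\<close> gives the constant \<open>C_p (\<alpha> + \<Lambda>) \<kappa> powr (1 -
  \<theta>) / (\<kappa> + \<Lambda>)\<close>, and \<open>s \<le> 1\<close> means
  \<open>\<kappa> \<ge> \<alpha>\<close>. As a function of \<kappa> it increases up to
  \<open>\<Lambda> (1 - \<theta>) / \<theta>\<close> and decreases afterwards. That point is the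
  threshold in \<open>mu_interp\<close>: below it the maximiser is allowed, above it the best
  allowed choice is \<open>\<kappa> = \<alpha>\<close>. Since \<open>mu_mag\<close> is a
  \<open>GREATEST\<close>, a greatest admissible constant must also be shown to exist. It is an
  infimum of real quotients over nonzero functions, which requires a nonempty set and finite
  p-norms; this shapes the final case distinction.\<close>

lemma Ck_lower: "Ck (Suc k) f \<Longrightarrow> Ck k f"
proof (induction k arbitrary: f)
  case 0
  then show ?case by (simp add: differentiable_imp_continuous_on)
next
  case (Suc k)
  then show ?case by (metis Ck.simps(2))
qed

lemma Ck_const: "Ck k (\<lambda>_. c)"
  by (induction k arbitrary: c) auto

lemma frechet_derivative_apply:
  "(f has_derivative f') (at x) \<Longrightarrow> frechet_derivative f (at x) v = f' v"
  by (simp add: frechet_derivative_at[symmetric])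

lemma Ck_add: "Ck k f \<Longrightarrow> Ck k g \<Longrightarrow> Ck k (\<lambda>x. f x + g x)"
proof (induction k arbitrary: f g)
  case 0
  then show ?case by (auto intro: continuous_intros)
next
  case (Suc k)
  then have d: "f differentiable_on UNIV" "g differentiable_on UNIV" by auto
  then have "frechet_derivative (\<lambda>x. f x + g x) (at x) v
      = frechet_derivative f (at x) v + frechet_derivative g (at x) v" for x v
    by (intro frechet_derivative_apply derivative_eq_intros)
       (auto simp: differentiable_on_def frechet_derivative_works)
  with Suc d show ?case by (auto intro!: derivative_intros)
qed

lemma Ck_mult: "Ck k f \<Longrightarrow> Ck k g \<Longrightarrow> Ck k (\<lambda>x. f x * g x)"
proof (induction k arbitrary: f g)
  case 0
  then show ?case by (auto intro: continuous_intros)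
next
  case (Suc k)
  then have d: "f differentiable_on UNIV" "g differentiable_on UNIV" by auto
  \<comment> \<open>The product rule leaves one factor undifferentiated, and the induction
    hypothesis needs that factor at order \<open>k\<close>.\<close>
  have l: "Ck k f" "Ck k g" using Suc.prems Ck_lower by blast+
  have "frechet_derivative (\<lambda>x. f x * g x) (at x) v
      = f x * frechet_derivative g (at x) v + frechet_derivative f (at x) v * g x" for x v
    using d by (intro frechet_derivative_apply derivative_eq_intros)
       (auto simp: differentiable_on_def frechet_derivative_works)
  with Suc d l show ?case
    by (auto intro!: derivative_intros Ck_add)
qed

lemma Ck_prod: "finite I \<Longrightarrow> (\<And>i. i \<in> I \<Longrightarrow> Ck k (f i)) \<Longrightarrow> Ck k (\<lambda>x. \<Prod>i\<in>I. f i x)"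
  by (induction I rule: finite_induct) (auto intro: Ck_const Ck_mult)

lemma frechet_derivative_affine:
  fixes f :: "'a::euclidean_space \<Rightarrow> real"
  assumes "f differentiable_on UNIV"
  shows "((\<lambda>x. f (c *\<^sub>R x + b)) has_derivative
           (\<lambda>v. c * frechet_derivative f (at (c *\<^sub>R x + b)) v)) (at x)"
proof -
  let ?f' = "frechet_derivative f (at (c *\<^sub>R x + b))"
  have f': "(f has_derivative ?f') (at (c *\<^sub>R x + b))"
    using assms by (simp add: differentiable_on_def frechet_derivative_works)
  have "((\<lambda>x. f (c *\<^sub>R x + b)) has_derivative (\<lambda>v. ?f' (c *\<^sub>R v))) (at x)"
    by (rule has_derivative_compose[where f="\<lambda>x. c *\<^sub>R x + b" and g=f, OF _ f'])
       (auto intro!: derivative_eq_intros)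
  then show ?thesis
    using has_derivative_linear[OF f'] by (simp add: linear_cmul)
qed

lemma Ck_affine:
  fixes f :: "'a::euclidean_space \<Rightarrow> real"
  shows "Ck k f \<Longrightarrow> Ck k (\<lambda>x. f (c *\<^sub>R x + b))"
proof (induction k arbitrary: f)
  case 0
  then show ?case
    by (auto intro!: continuous_on_compose2[of UNIV f] continuous_intros)
next
  case (Suc k)
  then have d: "f differentiable_on UNIV" by auto
  then have "frechet_derivative (\<lambda>x. f (c *\<^sub>R x + b)) (at x) v
      = c * frechet_derivative f (at (c *\<^sub>R x + b)) v" for x v
    by (intro frechet_derivative_apply frechet_derivative_affine)
  moreover have "(\<lambda>x. f (c *\<^sub>R x + b)) differentiable_on UNIV"
    using frechet_derivative_affine[OF d] unfolding differentiable_on_def differentiable_def by blast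
  ultimately show ?case
    using Suc.prems by (auto intro!: Ck_mult Ck_const Suc.IH)
qed

text \<open>Translations (\<open>c = 1\<close>) move increments of \<psi> onto the test function,
  dilations (\<open>b = 0\<close>) do the same for a rescaling. The new support lies in the preimage
  of the old one, an affine image of a compact set since \<open>c\<close> is nonzero.\<close>

lemma test_functions_affine:
  fixes \<phi> :: "'a::euclidean_space \<Rightarrow> real"
  assumes "\<phi> \<in> test_functions" "c \<noteq> 0"
  shows "(\<lambda>x. \<phi> (c *\<^sub>R x + b)) \<in> test_functions"
proof -
  let ?K = "closure {x. \<phi> x \<noteq> 0}"
  let ?L = "(\<lambda>y. (1 / c) *\<^sub>R (y - b)) ` ?K"
  have K: "compact ?K" and C: "\<And>k. Ck k \<phi>" using assms by (auto simp: test_functions_def)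
  have L: "compact ?L" by (intro compact_continuous_image K continuous_intros)
  have "{x. \<phi> (c *\<^sub>R x + b) \<noteq> 0} \<subseteq> ?L"
  proof
    fix x assume "x \<in> {x. \<phi> (c *\<^sub>R x + b) \<noteq> 0}"
    then have "c *\<^sub>R x + b \<in> ?K" by (auto intro: closure_subset[THEN subsetD])
    moreover have "x = (1 / c) *\<^sub>R ((c *\<^sub>R x + b) - b)" using assms by simp
    ultimately show "x \<in> ?L" by blast
  qed
  then have "closure {x. \<phi> (c *\<^sub>R x + b) \<noteq> 0} \<subseteq> ?L"
    using L by (simp add: closure_minimal compact_imp_closed)
  then have "compact (closure {x. \<phi> (c *\<^sub>R x + b) \<noteq> 0})"
    using L by (meson bounded_subset closed_closure compact_eq_bounded_closed)
  with C show ?thesis by (simp add: test_functions_def Ck_affine)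
qed

section \<open>Flat functions and smooth bumps supported in a box\<close>

definition flat_poly :: "real poly \<Rightarrow> real \<Rightarrow> real" where
  "flat_poly p t = (if t \<le> 0 then 0 else poly p (1 / t) * exp (- (1 / t)))"

text \<open>The free exponent \<open>k\<close> makes the induction on \<open>p\<close> work: peeling
  off a coefficient moves one factor \<open>y\<close> from the polynomial into the power. The case
  \<open>k = 1\<close>, \<open>y = 1 / h\<close> is the difference quotient of
  \<open>flat_poly\<close> at the origin.\<close>

lemma tendsto_poly_exp: "((\<lambda>y::real. y ^ k * poly p y * exp (- y)) \<longlongrightarrow> 0) at_top"
proof (induction p arbitrary: k)
  case 0
  then show ?case by simp
next
  case (pCons a p)
  have "((\<lambda>y::real. a * (y ^ k / exp y) + y ^ Suc k * poly p y * exp (- y)) \<longlongrightarrow> a * 0 + 0) at_top"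
    by (intro tendsto_intros tendsto_power_div_exp_0 pCons.IH)
  then show ?case by (simp add: algebra_simps exp_minus divide_inverse)
qed

text \<open>This family is closed under differentiation, which makes smoothness an induction.\<close>

lemma flat_poly_deriv:
  "(flat_poly p has_real_derivative flat_poly (monom 1 2 * (p - pderiv p)) t) (at t)"
proof (cases t "0::real" rule: linorder_cases)
  case less
  have "((\<lambda>_. 0) has_real_derivative 0) (at t)" by simp
  then have "(flat_poly p has_real_derivative 0) (at t)"
    by (rule has_field_derivative_transform_within_open[where S="{..<0}"]) (use less in \<open>auto simp: flat_poly_def\<close>)
  with less show ?thesis by (simp add: flat_poly_def)
next
  case greater
  \<comment> \<open>With \<open>y = 1 / t\<close> and \<open>y' = - y^2\<close>, the derivative of
    \<open>p(y) exp (- y)\<close> is \<open>y^2 (p - p')(y) exp (- y)\<close>, whence the polynomial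
    in the statement.\<close>
  have "((\<lambda>t. poly p (1 / t) * exp (- (1 / t))) has_real_derivative
     poly (monom 1 2 * (p - pderiv p)) (1 / t) * exp (- (1 / t))) (at t)"
    using greater
    by (auto intro!: derivative_eq_intros DERIV_chain'[OF _ poly_DERIV] 
        simp: poly_monom field_simps power2_eq_square)
  then have "(flat_poly p has_real_derivative poly (monom 1 2 * (p - pderiv p)) (1 / t) * exp (- (1 / t))) (at t)"
    by (rule has_field_derivative_transform_within_open[where S="{0<..}"]) (use greater in \<open>auto simp: flat_poly_def\<close>)
  with greater show ?thesis by (simp add: flat_poly_def)
next
  case equal
  have "((\<lambda>h. flat_poly p h / h) \<longlongrightarrow> 0) (at_left 0)"
    by (rule tendsto_eventually) (auto simp: eventually_at_filter flat_poly_def)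
  moreover have "((\<lambda>h. flat_poly p h / h) \<longlongrightarrow> 0) (at_right 0)"
  proof -
    have "((\<lambda>h::real. (1 / h) ^ 1 * poly p (1 / h) * exp (- (1 / h))) \<longlongrightarrow> 0) (at_right 0)"
      by (rule filterlim_compose[OF tendsto_poly_exp])
         (use filterlim_inverse_at_top_right in \<open>simp add: inverse_eq_divide\<close>)
    then show ?thesis
      by (rule Lim_transform_eventually) (auto simp: eventually_at_filter flat_poly_def)
  qed
  ultimately have "((\<lambda>h. flat_poly p h / h) \<longlongrightarrow> 0) (at 0)"
    by (simp add: filterlim_split_at)
  then show ?thesis using equal by (simp add: DERIV_def flat_poly_def)
qed

lemma Ck_flat_poly: "Ck k (\<lambda>x::'a::euclidean_space. flat_poly p (x \<bullet> e + c))"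
proof (induction k arbitrary: p)
  case 0
  have "continuous_on UNIV (flat_poly p)"
    using flat_poly_deriv by (auto intro!: continuous_at_imp_continuous_on DERIV_isCont)
  then show ?case
    by (auto intro!: continuous_on_compose2[of UNIV "flat_poly p"] continuous_intros)
next
  case (Suc k)
  let ?q = "monom 1 2 * (p - pderiv p)"
  have d: "((\<lambda>x::'a. flat_poly p (x \<bullet> e + c)) has_derivative (\<lambda>v. flat_poly ?q (x \<bullet> e + c) * (v \<bullet> e))) (at x)" for x
    by (rule has_derivative_compose[OF _ flat_poly_deriv[unfolded has_field_derivative_def]])
       (auto intro!: derivative_eq_intros)
  then have "frechet_derivative (\<lambda>x::'a. flat_poly p (x \<bullet> e + c)) (at x) v = flat_poly ?q (x \<bullet> e + c) * (v \<bullet> e)" for x v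
    by (rule frechet_derivative_apply)
  moreover have "(\<lambda>x::'a. flat_poly p (x \<bullet> e + c)) differentiable_on UNIV"
    using d unfolding differentiable_on_def differentiable_def by blast
  ultimately show ?case by (auto intro!: Ck_mult Ck_const Suc.IH)
qed

text \<open>The profile is \<open>exp (- 1 / (n t))\<close>, which tends to \<open>1\<close> for \<open>t > 0\<close> as \<open>n\<close> grows.\<close>

definition box_bump :: "'a::euclidean_space \<Rightarrow> 'a \<Rightarrow> real \<Rightarrow> 'a \<Rightarrow> real" where
  "box_bump a b n x =
     (\<Prod>i\<in>Basis. flat_poly 1 (n * (x \<bullet> i - a \<bullet> i)) * flat_poly 1 (n * (b \<bullet> i - x \<bullet> i)))"

lemma flat_poly_1: "0 \<le> flat_poly 1 t" "flat_poly 1 t \<le> 1" "flat_poly 1 t = 0 \<longleftrightarrow> t \<le> 0"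
  by (auto simp: flat_poly_def)

lemma box_bump_range: "0 \<le> box_bump a b n x" "box_bump a b n x \<le> 1"
  unfolding box_bump_def
  by (auto intro!: prod_nonneg prod_le_1 mult_nonneg_nonneg mult_le_one flat_poly_1)

lemma box_bump_eq_0:
  assumes "n > 0" "x \<notin> box a b" shows "box_bump a b n x = 0"
  using assms by (force simp: box_bump_def box_def flat_poly_1(3) mult_le_0_iff not_less)

lemma box_bump_test_function:
  fixes a :: "'a::euclidean_space"
  assumes "n > 0" shows "box_bump a b n \<in> test_functions"
proof -
  have "Ck k (box_bump a b n)" for k
  proof -
    have "Ck k (\<lambda>x. \<Prod>i\<in>Basis. flat_poly 1 (x \<bullet> (n *\<^sub>R i) + (- n * (a \<bullet> i))) * flat_poly 1 (x \<bullet> (- n *\<^sub>R i) + n * (b \<bullet> i)))"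
      by (intro Ck_prod Ck_mult Ck_flat_poly) auto
    also have "(\<lambda>x. \<Prod>i\<in>Basis. flat_poly 1 (x \<bullet> (n *\<^sub>R i) + (- n * (a \<bullet> i))) * flat_poly 1 (x \<bullet> (- n *\<^sub>R i) + n * (b \<bullet> i)))
        = box_bump a b n"
      by (auto simp: fun_eq_iff box_bump_def algebra_simps)
    finally show ?thesis .
  qed
  moreover have "closure {x. box_bump a b n x \<noteq> 0} \<subseteq> cbox a b"
    using box_bump_eq_0[OF assms] box_subset_cbox by (intro closure_minimal) blast+
  then have "compact (closure {x. box_bump a b n x \<noteq> 0})"
    by (meson bounded_cbox bounded_subset closed_closure compact_eq_bounded_closed)
  ultimately show ?thesis by (simp add: test_functions_def)
qed

lemma box_bump_tendsto:
  fixes a :: "'a::euclidean_space"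
  shows "(\<lambda>n. box_bump a b (real (Suc n)) x) \<longlonglongrightarrow> indicator (box a b) x"
proof (cases "x \<in> box a b")
  case False
  then show ?thesis by (simp add: box_bump_eq_0)
next
  case True
  have lim: "(\<lambda>n. flat_poly 1 (real (Suc n) * t)) \<longlonglongrightarrow> 1" if "t > 0" for t
  proof -
    have "(\<lambda>n. exp (- ((1 / t) * inverse (real (Suc n))))) \<longlonglongrightarrow> exp (- ((1 / t) * 0))"
      by (intro tendsto_intros LIMSEQ_inverse_real_of_nat)
    moreover have "exp (- ((1 / t) * inverse (real (Suc n)))) = flat_poly 1 (real (Suc n) * t)" for n
      using that by (simp add: flat_poly_def mult_le_0_iff inverse_eq_divide del: of_nat_Suc)
    ultimately show ?thesis by simp
  qed
  have "(\<lambda>n. box_bump a b (real (Suc n)) x) \<longlonglongrightarrow> (\<Prod>i\<in>(Basis::'a set). 1 * 1)"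
    unfolding box_bump_def using True
    by (intro tendsto_prod tendsto_mult lim) (auto simp: box_def)
  with True show ?thesis by simp
qed

section \<open>Locally integrable functions\<close>

text \<open>Borel measurability over \<open>lborel\<close>, instead of Lebesgue measurability as in
  \<open>Lq_loc\<close>, keeps compositions with translations and maps on product spaces measurable,
  so that Fubini applies. \<open>borel_representative\<close> and \<open>Lq_loc_1_loc_int\<close>
  lead from the one notion to the other.\<close>

definition loc_int :: "('a::euclidean_space \<Rightarrow> 'b::euclidean_space) \<Rightarrow> bool" where
  "loc_int f \<longleftrightarrow> f \<in> borel_measurable borel \<and>
     (\<forall>K. compact K \<longrightarrow> integrable lborel (\<lambda>x. indicator K x *\<^sub>R f x))"

lemma loc_int_measurable [measurable_dest]: "loc_int f \<Longrightarrow> f \<in> borel_measurable borel"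
  by (simp add: loc_int_def)

lemma loc_int_integrable: "loc_int f \<Longrightarrow> compact K \<Longrightarrow> integrable lborel (\<lambda>x. indicator K x *\<^sub>R f x)"
  by (simp add: loc_int_def)

lemma loc_int_bound:
  assumes "loc_int f" "g \<in> borel_measurable borel" "\<And>x. norm (g x) \<le> norm (f x)"
  shows "loc_int g"
  unfolding loc_int_def
proof (intro conjI allI impI)
  fix K :: "'a set" assume K: "compact K"
  have [measurable]: "K \<in> sets borel" using K by (simp add: borel_compact)
  note [measurable] = assms(2)
  show "integrable lborel (\<lambda>x. indicator K x *\<^sub>R g x)"
    by (rule Bochner_Integration.integrable_bound[OF loc_int_integrable[OF assms(1) K]])
       (auto simp: assms(3) indicator_def)
qed (fact assms)

lemma loc_int_diff:
  assumes "loc_int f" "loc_int g" shows "loc_int (\<lambda>x. f x - g x)"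
  using assms by (auto simp: loc_int_def scaleR_diff_right)

lemma test_function_support:
  assumes "\<phi> \<in> test_functions"
  obtains K where "compact K" "\<And>x. x \<notin> K \<Longrightarrow> \<phi> x = 0"
proof (rule that)
  show "compact (closure {x. \<phi> x \<noteq> 0})" using assms by (simp add: test_functions_def)
  show "\<phi> x = 0" if "x \<notin> closure {x. \<phi> x \<noteq> 0}" for x
    using that closure_subset[of "{x. \<phi> x \<noteq> 0}"] by auto
qed

lemma continuous_compact_support_bounded:
  fixes g :: "'a::euclidean_space \<Rightarrow> real"
  assumes "continuous_on UNIV g" "compact K" "\<And>x. x \<notin> K \<Longrightarrow> g x = 0"
  obtains M where "0 \<le> M" "\<And>x. \<bar>g x\<bar> \<le> M"
proof -
  have "bounded (g ` K)"
    by (intro compact_imp_bounded compact_continuous_image assms continuous_on_subset[OF assms(1)]) auto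
  then obtain M where M: "M > 0" "\<And>x. x \<in> K \<Longrightarrow> \<bar>g x\<bar> \<le> M" 
    unfolding bounded_pos by auto
  show ?thesis
    by (rule that[of M]) (use M assms(3) in \<open>force+\<close>)
qed

lemma loc_int_mult_integrable:
  fixes g :: "'a::euclidean_space \<Rightarrow> real"
  assumes "loc_int f" "g \<in> borel_measurable borel" "compact K"
    and "\<And>x. x \<notin> K \<Longrightarrow> g x = 0" "\<And>x. \<bar>g x\<bar> \<le> M"
  shows "integrable lborel (\<lambda>x. g x *\<^sub>R f x)"
proof (rule Bochner_Integration.integrable_bound)
  show "integrable lborel (\<lambda>x. M *\<^sub>R (indicator K x *\<^sub>R f x))"
    using assms by (intro integrable_scaleR_right loc_int_integrable)
  show "(\<lambda>x. g x *\<^sub>R f x) \<in> borel_measurable lborel"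
    using assms(2) loc_int_measurable[OF assms(1)] by simp
  have "norm (g x *\<^sub>R f x) \<le> norm (M *\<^sub>R (indicator K x *\<^sub>R f x))" for x
    using assms(4)[of x] assms(5)[of x] by (cases "x \<in> K") (auto intro: mult_right_mono)
  then show "AE x in lborel. norm (g x *\<^sub>R f x) \<le> norm (M *\<^sub>R (indicator K x *\<^sub>R f x))"
    by simp
qed

lemma test_function_continuous: "\<phi> \<in> test_functions \<Longrightarrow> continuous_on UNIV \<phi>"
  unfolding test_functions_def by (metis (mono_tags, lifting) Ck.simps(1) mem_Collect_eq)

lemma test_function_integrable:
  assumes "loc_int f" "\<phi> \<in> test_functions"
  shows "integrable lborel (\<lambda>x. \<phi> x *\<^sub>R f x)"
proof -
  obtain K where K: "compact K" "\<And>x. x \<notin> K \<Longrightarrow> \<phi> x = 0"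
    using test_function_support[OF assms(2)] by blast
  note c = test_function_continuous[OF assms(2)]
  obtain M where "\<And>x. \<bar>\<phi> x\<bar> \<le> M"
    using continuous_compact_support_bounded[OF c K] by blast
  then show ?thesis
    by (intro loc_int_mult_integrable[OF assms(1) _ K]) (use c in \<open>auto intro: borel_measurable_continuous_onI\<close>)
qed

lemma AE_lborel_negligible:
  assumes "negligible N" "\<And>x. x \<notin> N \<Longrightarrow> P x"
  shows "AE x in lborel. P x"
proof -
  have "N \<in> null_sets lebesgue" using assms(1) by (simp add: negligible_iff_null_sets)
  then have "AE x in lebesgue. x \<notin> N" by (rule AE_not_in)
  then have "AE x in lebesgue. P x" by eventually_elim (rule assms(2))
  then show ?thesis by (simp add: AE_completion_iff)
qed

text \<open>The bumps converge boundedly to the indicator of a box, so all integrals of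
  \<open>v\<close> over boxes vanish; Lebesgue differentiation then recovers \<open>v\<close> from
  its averages.\<close>

lemma fundamental_lemma_calculus_of_variations:
  fixes v :: "'a::euclidean_space \<Rightarrow> 'b::euclidean_space"
  assumes v: "loc_int v"
    and zero: "\<And>\<phi>. \<phi> \<in> test_functions \<Longrightarrow> (LINT x|lborel. \<phi> x *\<^sub>R v x) = 0"
  shows "AE x in lborel. v x = 0"
proof -
  note [measurable] = loc_int_measurable[OF v]
  have si: "set_integrable lborel (cbox a b) v" for a b
    using loc_int_integrable[OF v compact_cbox] by (simp add: set_integrable_def)
  have box: "integral (cbox a b) v = 0" for a b
  proof -
    have [measurable]: "box_bump a b n \<in> borel_measurable borel" if "n > 0" for n
      by (intro borel_measurable_continuous_onI test_function_continuous box_bump_test_function that)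
    have "(\<lambda>n. LINT x|lborel. box_bump a b (real (Suc n)) x *\<^sub>R v x)
        \<longlonglongrightarrow> (LINT x|lborel. indicator (box a b) x *\<^sub>R v x)"
    proof (rule integral_dominated_convergence[where w="\<lambda>x. norm (indicator (cbox a b) x *\<^sub>R v x)"])
      show "integrable lborel (\<lambda>x. norm (indicator (cbox a b) x *\<^sub>R v x))"
        using si unfolding set_integrable_def by (rule integrable_norm)
      have "norm (box_bump a b (real (Suc n)) x *\<^sub>R v x) \<le> norm (indicator (cbox a b) x *\<^sub>R v x)" for n x
        using box_bump_range[of a b "real (Suc n)" x] box_bump_eq_0[of "real (Suc n)" x a b] box_subset_cbox[of a b]
        by (cases "x \<in> box a b") (auto simp: indicator_def intro!: mult_left_le_one_le)
      then show "AE x in lborel. norm (box_bump a b (real (Suc n)) x *\<^sub>R v x) \<le> norm (indicator (cbox a b) x *\<^sub>R v x)" for n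
        by simp
      show "AE x in lborel. (\<lambda>n. box_bump a b (real (Suc n)) x *\<^sub>R v x) \<longlonglongrightarrow> indicator (box a b) x *\<^sub>R v x"
        by (intro AE_I2 tendsto_intros box_bump_tendsto)
    qed (auto simp del: of_nat_Suc)
    moreover have "(LINT x|lborel. box_bump a b (real (Suc n)) x *\<^sub>R v x) = 0" for n
      by (intro zero box_bump_test_function) simp
    ultimately have "(LINT x|lborel. indicator (box a b) x *\<^sub>R v x) = 0"
      by (simp add: LIMSEQ_const_iff del: of_nat_Suc)
    moreover have "set_integrable lborel (box a b) v"
      by (rule set_integrable_subset[OF si]) (auto intro: box_subset_cbox[THEN subsetD])
    note set_borel_integral_eq_integral(2)[OF this]
    ultimately have "integral (box a b) v = 0"
      by (simp add: set_lebesgue_integral_def)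
    then show ?thesis by (simp add: integral_open_interval)
  qed
  have "v integrable_on cbox a b" for a b
    using si by (rule set_borel_integral_eq_integral(1))
  \<comment> \<open>Lebesgue's differentiation theorem, with averages over the cubes that have
    \<open>x\<close> as their lower corner.\<close>
  then obtain N where N: "negligible N"
    "\<And>x e. \<lbrakk>x \<notin> N; 0 < e\<rbrakk> \<Longrightarrow> \<exists>d>0. \<forall>h. 0 < h \<and> h < d \<longrightarrow>
       norm(integral (cbox x (x + h *\<^sub>R One)) v /\<^sub>R h ^ DIM('a) - v x) < e"
    using integrable_ccontinuous_explicit by blast
  have "v x = 0" if xN: "x \<notin> N" for x
  proof (rule ccontr)
    \<comment> \<open>All averages are zero, so a tolerance of \<open>norm (v x)\<close> yields
      \<open>norm (v x) < norm (v x)\<close>.\<close>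
    assume "v x \<noteq> 0"
    then obtain d where d: "d > 0" "\<And>h. 0 < h \<Longrightarrow> h < d \<Longrightarrow>
       norm(integral (cbox x (x + h *\<^sub>R One)) v /\<^sub>R h ^ DIM('a) - v x) < norm (v x)"
      using N(2)[OF xN, of "norm (v x)"] by auto
    show False using d(2)[of "d/2"] d(1) by (simp add: box)
  qed
  then show ?thesis by (rule AE_lborel_negligible[OF N(1)])
qed

section \<open>Translations: invariance of the integral and continuity in \<open>L^1\<close>\<close>

lemma lborel_translate:
  fixes f :: "'a::euclidean_space \<Rightarrow> 'b::{banach, second_countable_topology}"
  assumes [measurable]: "f \<in> borel_measurable borel"
  shows integral_lborel_translate: "(LINT x|lborel. f (x + c)) = (LINT x|lborel. f x)"
    and integrable_lborel_translate: "integrable lborel (\<lambda>x. f (x + c)) \<longleftrightarrow> integrable lborel f"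
proof -
  have "(LINT x|distr lborel borel ((+) c). f x) = (LINT x|lborel. f (c + x))"
    by (rule integral_distr) auto
  then show "(LINT x|lborel. f (x + c)) = (LINT x|lborel. f x)"
    by (simp add: lborel_distr_plus add.commute)
  have "integrable (distr lborel borel ((+) c)) f \<longleftrightarrow> integrable lborel (\<lambda>x. f (c + x))"
    by (rule integrable_distr_eq) auto
  then show "integrable lborel (\<lambda>x. f (x + c)) \<longleftrightarrow> integrable lborel f"
    by (simp add: lborel_distr_plus add.commute)
qed

text \<open>Outer regularity gives an open \<open>U\<close> around \<open>A\<close> with
  \<open>U - A\<close> small. A point of \<open>A\<close> that leaves \<open>A\<close> either leaves
  \<open>U\<close>, which eventually fails for each fixed point because \<open>U\<close> is open, or
  lands in \<open>U - A\<close>, and the set of such points is a translate of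
  \<open>U - A\<close>.\<close>

lemma measure_translate_escape:
  fixes A :: "'a::euclidean_space set"
  assumes A[measurable]: "A \<in> sets borel" and fin: "emeasure lborel A < \<infinity>" and h: "h \<longlonglongrightarrow> 0"
  shows "(\<lambda>n. measure lborel {x \<in> A. x + h n \<notin> A}) \<longlonglongrightarrow> 0"
proof (rule LIMSEQ_I)
  fix e :: real assume e: "e > 0"
  obtain U where U: "open U" "A \<subseteq> U" "emeasure lebesgue (U - A) < ennreal (e/3)"
    by (rule sets_lebesgue_outer_open[of A "e/3"]) (use e A in auto)
  note [measurable] = borel_open[OF U(1)]
  have UA: "emeasure lborel (U - A) < ennreal (e/3)" using U(3) by (simp add: main_part_sets)
  have "(\<lambda>n. LINT x|lborel. indicator {x \<in> A. x + h n \<notin> U} x :: real) \<longlonglongrightarrow> (LINT x|(lborel::'a measure). 0)"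
  proof (rule integral_dominated_convergence[where w="indicator A"])
    show "integrable lborel (indicator A :: 'a \<Rightarrow> real)" using fin by simp
    have "(\<lambda>n. indicator {x \<in> A. x + h n \<notin> U} x :: real) \<longlonglongrightarrow> 0" for x
    proof (cases "x \<in> A")
      case True
      have "(\<lambda>n. x + h n) \<longlonglongrightarrow> x + 0" by (intro tendsto_intros h)
      then have "eventually (\<lambda>n. x + h n \<in> U) sequentially"
        using U True by (auto simp: tendsto_def)
      then show ?thesis by (intro tendsto_eventually) (auto elim: eventually_mono)
    qed auto
    then show "AE x in lborel. (\<lambda>n. indicator {x \<in> A. x + h n \<notin> U} x :: real) \<longlonglongrightarrow> 0" by simp
  qed (auto simp: indicator_def)
  then have "(\<lambda>n. measure lborel {x \<in> A. x + h n \<notin> U}) \<longlonglongrightarrow> 0" by simp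
  from LIMSEQ_D[OF this, of "e/3"] e
  obtain N where N0: "\<forall>n\<ge>N. norm (measure lborel {x \<in> A. x + h n \<notin> U} - 0) < e / 3"
    by (meson divide_pos_pos zero_less_numeral)
  have N: "measure lborel {x \<in> A. x + h n \<notin> U} < e / 3" if "n \<ge> N" for n
    using N0[rule_format, OF that] by simp
  show "\<exists>N. \<forall>n\<ge>N. norm (measure lborel {x \<in> A. x + h n \<notin> A} - 0) < e"
  proof (intro exI[of _ N] allI impI)
    fix n assume "n \<ge> N"
    let ?T = "(\<lambda>x. x + h n) -` (U - A)"
    have [measurable]: "?T \<in> sets borel"
      using measurable_sets[of "\<lambda>x. x + h n" borel borel "U - A"] by simp
    have "emeasure lborel ?T = emeasure (distr lborel borel ((+) (h n))) (U - A)"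
      by (subst emeasure_distr) (auto simp: add.commute vimage_def)
    then have T: "emeasure lborel ?T < ennreal (e/3)" using UA by (simp add: lborel_distr_plus)
    have "measure lborel {x \<in> A. x + h n \<notin> A} \<le> measure lborel ({x \<in> A. x + h n \<notin> U} \<union> ?T)"
    proof (rule measure_mono_fmeasurable)
      have "{x \<in> A. x + h n \<notin> U} \<in> fmeasurable lborel"
        by (rule fmeasurableI2[of A]) (use fin in \<open>auto simp: fmeasurable_def\<close>)
      moreover have "?T \<in> fmeasurable lborel"
        using T by (auto simp: fmeasurable_def intro: order.strict_trans)
      ultimately show "{x \<in> A. x + h n \<notin> U} \<union> ?T \<in> fmeasurable lborel" by (rule fmeasurable.Un)
    qed auto
    also have "\<dots> \<le> measure lborel {x \<in> A. x + h n \<notin> U} + measure lborel ?T"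
      by (rule measure_Un_le) auto
    also have "measure lborel ?T \<le> e / 3"
      using enn2real_mono[of "emeasure lborel ?T" "ennreal (e/3)"] T e by (simp add: measure_def)
    finally show "norm (measure lborel {x \<in> A. x + h n \<notin> A} - 0) < e"
      using N[OF \<open>n \<ge> N\<close>] e by simp
  qed
qed

text \<open>Proved by approximation from indicators upwards: indicators reduce to
  \<open>measure_translate_escape\<close>, sums to the triangle inequality, and limits to a
  three-term estimate in which the two approximation errors agree by translation invariance.\<close>

lemma L1_translation_continuous:
  fixes f :: "'a::euclidean_space \<Rightarrow> 'b::{banach, second_countable_topology}"
  assumes "integrable lborel f" and h: "h \<longlonglongrightarrow> 0"
  shows "(\<lambda>n. LINT x|lborel. norm (f (x + h n) - f x)) \<longlonglongrightarrow> 0"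
  using assms(1)
proof (induction rule: integrable_induct)
  case (base A c)
  then have [measurable]: "A \<in> sets borel" by simp
  let ?E = "\<lambda>t. {x \<in> A. x + t \<notin> A}"
  have fin: "emeasure lborel (?E t) < \<infinity>" for t
    using base(2) emeasure_mono[of "?E t" A lborel] by (auto intro: order.strict_trans1)
  have int: "integrable lborel (indicator (?E t) :: _ \<Rightarrow> real)" for t
    using fin by (intro integrable_real_indicator) auto
  have "(LINT x|lborel. norm (indicat_real A (x + h n) *\<^sub>R c - indicat_real A x *\<^sub>R c))
      = norm c * (measure lborel (?E (h n)) + measure lborel (?E (- h n)))" for n
  proof -
    \<comment> \<open>The two indicators differ where \<open>x\<close> leaves \<open>A\<close> under
      the shift \<open>h n\<close>, or where \<open>x\<close> enters it, that is, where
      \<open>x + h n\<close> leaves \<open>A\<close> under the reverse shift.\<close>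
    have "norm (indicat_real A (x + h n) *\<^sub>R c - indicat_real A x *\<^sub>R c)
        = norm c * (indicat_real (?E (h n)) x + indicat_real (?E (- h n)) (x + h n))" for x
      by (auto simp: indicator_def)
    moreover have "(LINT x|lborel. indicat_real (?E (- h n)) (x + h n)) = measure lborel (?E (- h n))"
      by (subst integral_lborel_translate) auto
    moreover have "integrable lborel (\<lambda>x. indicat_real (?E (- h n)) (x + h n))"
      by (subst integrable_lborel_translate) (auto simp: int[of "- h n", simplified])
    ultimately show ?thesis using int by simp
  qed
  moreover have "(\<lambda>n. norm c * (measure lborel (?E (h n)) + measure lborel (?E (- h n)))) \<longlonglongrightarrow> norm c * (0 + 0)"
    by (intro tendsto_intros measure_translate_escape h tendsto_minus_cancel_left[THEN iffD1]) 
       (use base h in \<open>auto intro: tendsto_eq_intros\<close>)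
  ultimately show ?case by simp
next
  case (add f g)
  note [measurable] = borel_measurable_integrable[OF add.hyps(1)] borel_measurable_integrable[OF add.hyps(2)]
  have i: "integrable lborel (\<lambda>x. u (x + t))" if "integrable lborel u" for u :: "'a \<Rightarrow> 'b" and t
    using that borel_measurable_integrable[OF that] by (subst integrable_lborel_translate) auto
  show ?case
  proof (rule tendsto_sandwich[OF _ _ tendsto_const])
    show "(\<lambda>n. (LINT x|lborel. norm (f (x + h n) - f x)) + (LINT x|lborel. norm (g (x + h n) - g x))) \<longlonglongrightarrow> 0"
      using tendsto_add[OF add.IH] by simp
    show "\<forall>\<^sub>F n in sequentially. (LINT x|lborel. norm (f (x + h n) + g (x + h n) - (f x + g x)))
      \<le> (LINT x|lborel. norm (f (x + h n) - f x)) + (LINT x|lborel. norm (g (x + h n) - g x))"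
    proof (intro always_eventually allI)
      fix n
      have d: "integrable lborel (\<lambda>x. norm (f (x + h n) - f x))" "integrable lborel (\<lambda>x. norm (g (x + h n) - g x))"
        by (intro integrable_norm Bochner_Integration.integrable_diff i add.hyps)+
      show "(LINT x|lborel. norm (f (x + h n) + g (x + h n) - (f x + g x)))
        \<le> (LINT x|lborel. norm (f (x + h n) - f x)) + (LINT x|lborel. norm (g (x + h n) - g x))"
        unfolding Bochner_Integration.integral_add[OF d, symmetric]
      proof (intro integral_mono Bochner_Integration.integrable_add d)
        show "integrable lborel (\<lambda>x. norm (f (x + h n) + g (x + h n) - (f x + g x)))"
          by (intro integrable_norm Bochner_Integration.integrable_diff Bochner_Integration.integrable_add i add.hyps)
        show "norm (f (x + h n) + g (x + h n) - (f x + g x)) \<le> norm (f (x + h n) - f x) + norm (g (x + h n) - g x)" for x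
          by (metis add_diff_add norm_triangle_ineq)
      qed
    qed
  qed auto
next
  case (lim f s)
  have i: "integrable lborel (\<lambda>x. u (x + t))" if "integrable lborel u" for u :: "'a \<Rightarrow> 'b" and t
    using that borel_measurable_integrable[OF that] by (subst integrable_lborel_translate) auto
  have d: "integrable lborel (\<lambda>x. norm (u x - w x))" if "integrable lborel u" "integrable lborel w" for u w :: "'a \<Rightarrow> 'b"
    using that by (intro integrable_norm Bochner_Integration.integrable_diff)
  \<comment> \<open>The approximants obey \<open>norm (s k x) \<le> 2 * norm (f x)\<close>, hence
    the factor 3 in the dominating function.\<close>
  have s: "(\<lambda>k. LINT x|lborel. norm (s k x - f x)) \<longlonglongrightarrow> (LINT x|(lborel::'a measure). 0)"
  proof (rule integral_dominated_convergence[where w="\<lambda>x. 3 * norm (f x)"])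
    show "AE x in lborel. (\<lambda>k. norm (s k x - f x)) \<longlonglongrightarrow> 0"
      using lim.hyps(2) by (auto intro!: tendsto_norm_zero LIM_zero)
    have "norm (s k x - f x) \<le> 3 * norm (f x)" for k x
      using lim.hyps(3)[of x k] norm_triangle_ineq4[of "s k x" "f x"] by simp
    then show "AE x in lborel. norm (norm (s k x - f x)) \<le> 3 * norm (f x)" for k by simp
  qed (use borel_measurable_integrable[OF lim.hyps(1)] borel_measurable_integrable[OF lim.hyps(4)] lim.hyps(4) in auto)
  show ?case
  proof (rule LIMSEQ_I)
    fix e :: real assume e: "e > 0"
    obtain k where k: "(LINT x|lborel. norm (s k x - f x)) < e / 3"
      using LIMSEQ_D[OF s, of "e/3"] e by (auto simp: integral_nonneg)
    obtain N where N: "\<And>n. n \<ge> N \<Longrightarrow> (LINT x|lborel. norm (s k (x + h n) - s k x)) < e / 3"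
      using LIMSEQ_D[OF lim.IH[of k], of "e/3"] e by (auto simp: integral_nonneg)
    show "\<exists>N. \<forall>n\<ge>N. norm ((LINT x|lborel. norm (f (x + h n) - f x)) - 0) < e"
    proof (intro exI[of _ N] allI impI)
      fix n assume n: "n \<ge> N"
      let ?a = "\<lambda>x. norm (s k (x + h n) - f (x + h n))"
      let ?b = "\<lambda>x. norm (s k (x + h n) - s k x)" 
      let ?c = "\<lambda>x. norm (s k x - f x)"
      have int: "integrable lborel ?a" "integrable lborel ?b" "integrable lborel ?c"
        using lim.hyps by (auto intro!: d i simp del: integrable_lborel_translate)
      have "norm (f (x + h n) - f x) \<le> ?a x + ?b x + ?c x" for x
        by norm
      then have "(LINT x|lborel. norm (f (x + h n) - f x)) \<le> (LINT x|lborel. ?a x + ?b x + ?c x)"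
        using lim.hyps int by (intro integral_mono d i) auto
      also have "\<dots> = (LINT x|lborel. ?a x) + (LINT x|lborel. ?b x) + (LINT x|lborel. ?c x)"
        using int by simp
      also have "(LINT x|lborel. ?a x) = (LINT x|lborel. ?c x)"
        using borel_measurable_integrable[OF lim.hyps(1)[of k]] borel_measurable_integrable[OF lim.hyps(4)]
        by (subst integral_lborel_translate[of "\<lambda>x. norm (s k x - f x)" "h n"]) auto
      finally show "norm ((LINT x|lborel. norm (f (x + h n) - f x)) - 0) < e"
        using k N[OF n] by (simp add: integral_nonneg)
    qed
  qed
qed

section \<open>Difference quotients of weakly differentiable functions\<close>

lemma test_function_differentiable: "\<phi> \<in> test_functions \<Longrightarrow> \<phi> differentiable_on UNIV"
  unfolding test_functions_def by (metis (mono_tags, lifting) Ck.simps(2) mem_Collect_eq)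

lemma test_function_has_derivative:
  "\<phi> \<in> test_functions \<Longrightarrow> (\<phi> has_derivative frechet_derivative \<phi> (at x)) (at x)"
  using test_function_differentiable[of \<phi>] by (simp add: differentiable_on_def frechet_derivative_works)

lemma test_function_deriv_scale:
  "\<phi> \<in> test_functions \<Longrightarrow>
    frechet_derivative \<phi> (at x) (c *\<^sub>R w) = c * frechet_derivative \<phi> (at x) w"
  using linear_cmul[OF has_derivative_linear[OF test_function_has_derivative]] by simp

lemma test_function_deriv_continuous:
  assumes "\<phi> \<in> test_functions" shows "continuous_on UNIV (\<lambda>x. frechet_derivative \<phi> (at x) w)"
proof -
  have "Ck (Suc 0) \<phi>" using assms unfolding test_functions_def by blast
  then show ?thesis by simp
qed

lemma test_function_bounds:
  fixes \<phi> :: "'a::euclidean_space \<Rightarrow> real"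
  assumes \<phi>: "\<phi> \<in> test_functions"
  obtains K M where "compact K" "\<And>x. x \<notin> K \<Longrightarrow> \<phi> x = 0"
    "\<And>x. x \<notin> K \<Longrightarrow> frechet_derivative \<phi> (at x) w = 0" "0 \<le> M"
    "\<And>x. \<bar>\<phi> x\<bar> \<le> M" "\<And>x. \<bar>frechet_derivative \<phi> (at x) w\<bar> \<le> M"
proof -
  obtain K where K: "compact K" "\<And>x. x \<notin> K \<Longrightarrow> \<phi> x = 0"
    using test_function_support[OF \<phi>] by blast
  have K': "frechet_derivative \<phi> (at x) w = 0" if "x \<notin> K" for x
  proof (rule frechet_derivative_apply)
    have "((\<lambda>_. 0) has_derivative (\<lambda>_. 0)) (at x)" by simp
    then show "(\<phi> has_derivative (\<lambda>_. 0)) (at x)"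
      by (rule has_derivative_transform_within_open[where s="- K"])
         (use that K in \<open>auto simp: compact_imp_closed open_Compl\<close>)
  qed
  obtain M1 where M1: "\<And>x. \<bar>\<phi> x\<bar> \<le> M1"
    using continuous_compact_support_bounded[OF test_function_continuous[OF \<phi>] K] by blast
  obtain M2 where M2: "0 \<le> M2" "\<And>x. \<bar>frechet_derivative \<phi> (at x) w\<bar> \<le> M2"
    using continuous_compact_support_bounded[OF test_function_deriv_continuous[OF \<phi>] K(1) K'] by blast
  show ?thesis
    by (rule that[of K "max M1 M2", OF K K']) (use M1 M2 in \<open>auto simp: le_max_iff_disj\<close>)
qed

text \<open>The fundamental theorem of calculus on the segment from \<open>x\<close> to
  \<open>x - w\<close>. It runs backwards because a shift of \<psi> by \<open>w\<close> becomes a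
  shift of the test function by \<open>- w\<close>.\<close>

lemma test_function_increment:
  fixes \<phi> :: "'a::euclidean_space \<Rightarrow> real"
  assumes \<phi>: "\<phi> \<in> test_functions"
  shows "\<phi> (x - w) - \<phi> x =
    - (LINT s|lborel. indicator {0..1} s *\<^sub>R frechet_derivative \<phi> (at (x - s *\<^sub>R w)) w)"
proof -
  let ?D = "\<lambda>s. - frechet_derivative \<phi> (at (x - s *\<^sub>R w)) w"
  have "(LINT s|lborel. indicator {0..1::real} s *\<^sub>R ?D s) = \<phi> (x - 1 *\<^sub>R w) - \<phi> (x - 0 *\<^sub>R w)"
  proof (rule integral_FTC_Icc)
    fix s :: real
    have "((\<lambda>s. \<phi> (x - s *\<^sub>R w)) has_derivative
            (\<lambda>t. frechet_derivative \<phi> (at (x - s *\<^sub>R w)) (- (t *\<^sub>R w)))) (at s within {0..1})"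
      by (rule has_derivative_compose[where f="\<lambda>s. x - s *\<^sub>R w" and g=\<phi>, OF _ test_function_has_derivative[OF \<phi>]])
         (auto intro!: derivative_eq_intros)
    moreover have "frechet_derivative \<phi> (at (x - s *\<^sub>R w)) (- (t *\<^sub>R w)) = t *\<^sub>R ?D s" for t
      using test_function_deriv_scale[OF \<phi>, of _ "- t" w] by simp
    ultimately show "((\<lambda>s. \<phi> (x - s *\<^sub>R w)) has_vector_derivative ?D s) (at s within {0..1})"
      by (simp add: has_vector_derivative_def)
  next
    show "continuous_on {0..1} ?D"
      by (intro continuous_on_minus continuous_on_compose2[OF test_function_deriv_continuous[OF \<phi>]] continuous_intros) auto
  qed simp
  then show ?thesis by simp
qed

text \<open>A directional form of \<open>has_weak_grad\<close> for Borel functions. The general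
  codomain serves both \<psi> and its real modulus; the general direction lets the step length be
  absorbed into \<open>w\<close>.\<close>

definition weak_deriv ::
  "'a::euclidean_space \<Rightarrow> ('a \<Rightarrow> 'b::euclidean_space) \<Rightarrow> ('a \<Rightarrow> 'b) \<Rightarrow> bool" where
  "weak_deriv w \<psi> f \<longleftrightarrow> loc_int \<psi> \<and> loc_int f \<and>
     (\<forall>\<phi>\<in>test_functions. (LINT x|lborel. frechet_derivative \<phi> (at x) w *\<^sub>R \<psi> x)
        = - (LINT x|lborel. \<phi> x *\<^sub>R f x))"

lemma loc_int_scaleR: "loc_int f \<Longrightarrow> loc_int (\<lambda>x. c *\<^sub>R f x)"
  by (auto simp: loc_int_def scaleR_left_commute[of _ c] simp del: scaleR_scaleR)

lemma weak_deriv_scale: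
  assumes "weak_deriv w \<psi> f" shows "weak_deriv (c *\<^sub>R w) \<psi> (\<lambda>x. c *\<^sub>R f x)"
proof -
  have "loc_int (\<lambda>x. c *\<^sub>R f x)"
    using assms by (simp add: weak_deriv_def loc_int_scaleR)
  then show ?thesis
    using assms
    by (auto simp: weak_deriv_def test_function_deriv_scale scaleR_left_commute[of _ c]
             simp flip: scaleR_scaleR)
qed

text \<open>A compact set containing every translate of \<open>K\<close> by at most one multiple of
  \<open>w\<close> in either direction. Truncating a locally integrable function to it gives an
  integrable function that still agrees with the original along all these shifts.\<close>

definition sweep :: "'a::euclidean_space \<Rightarrow> 'a set \<Rightarrow> 'a set" where
  "sweep w K = (\<lambda>(s, x). x + s *\<^sub>R w) ` ({-1..1::real} \<times> K)"

lemma compact_sweep: "compact K \<Longrightarrow> compact (sweep w K)"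
  unfolding sweep_def
  by (intro compact_continuous_image compact_Times) (auto intro!: continuous_intros simp: split_beta)

lemma in_sweep: "x \<in> K \<Longrightarrow> \<bar>s\<bar> \<le> 1 \<Longrightarrow> x + s *\<^sub>R w \<in> sweep w K"
  unfolding sweep_def by force

text \<open>All slices in \<open>x\<close> have the same \<open>L^1\<close> norm by translation
  invariance, so the iterated integral of the norm is finite and Tonelli applies.\<close>

lemma product_integrable_translate:
  fixes f :: "'a::euclidean_space \<Rightarrow> 'b::euclidean_space"
  assumes f: "integrable lborel f"
  shows "integrable (lborel \<Otimes>\<^sub>M lborel) (\<lambda>(s, x). indicator {0..1::real} s *\<^sub>R f (x + s *\<^sub>R w))"
proof (rule lborel_pair.Fubini_integrable)
  have [measurable]: "f \<in> borel_measurable borel" using f by auto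
  show "(\<lambda>(s, x). indicator {0..1::real} s *\<^sub>R f (x + s *\<^sub>R w)) \<in> borel_measurable (lborel \<Otimes>\<^sub>M lborel)"
    by measurable
  have "(LINT x|lborel. norm (f (x + s *\<^sub>R w))) = (LINT x|lborel. norm (f x))" for s
    by (subst integral_lborel_translate[of "\<lambda>x. norm (f x)"]) auto
  then show "integrable lborel (\<lambda>s. LINT x|lborel. norm (case (s, x) of (s, x) \<Rightarrow> indicator {0..1::real} s *\<^sub>R f (x + s *\<^sub>R w)))"
    by simp
  show "AE s in lborel. integrable lborel (\<lambda>x. case (s, x) of (s, x) \<Rightarrow> indicator {0..1::real} s *\<^sub>R f (x + s *\<^sub>R w))"
    using f by (auto intro!: integrable_scaleR_right simp: integrable_lborel_translate)
qed

text \<open>Where the weight \<open>g\<close> and the indicator of \<open>{0..1}\<close> are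
  nonzero, \<open>x + s w\<close> lies in \<open>sweep w K\<close>, so \<open>f\<close> may be
  replaced by its integrable truncation. This supplies the Fubini hypotheses below.\<close>

lemma product_integrable_loc_int:
  fixes f :: "'a::euclidean_space \<Rightarrow> 'b::euclidean_space" and g :: "real \<Rightarrow> 'a \<Rightarrow> real"
  assumes f: "loc_int f" and K: "compact K"
    and [measurable]: "(\<lambda>(s, x). g s x) \<in> borel_measurable (lborel \<Otimes>\<^sub>M lborel)"
    and g0: "\<And>s x. 0 \<le> s \<Longrightarrow> s \<le> 1 \<Longrightarrow> x \<notin> K \<Longrightarrow> g s x = 0" and gM: "\<And>s x. \<bar>g s x\<bar> \<le> M"
  shows "integrable (lborel \<Otimes>\<^sub>M lborel)
    (\<lambda>(s, x). indicator {0..1::real} s *\<^sub>R (g s x *\<^sub>R f (x + s *\<^sub>R w)))"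
proof (rule Bochner_Integration.integrable_bound)
  note [measurable] = loc_int_measurable[OF f]
  let ?f = "\<lambda>x. indicator (sweep w K) x *\<^sub>R f x"
  show "integrable (lborel \<Otimes>\<^sub>M lborel)
     (\<lambda>z. M *\<^sub>R (case z of (s, x) \<Rightarrow> indicator {0..1::real} s *\<^sub>R ?f (x + s *\<^sub>R w)))"
    by (intro integrable_scaleR_right product_integrable_translate loc_int_integrable f compact_sweep K)
  show "(\<lambda>(s, x). indicator {0..1::real} s *\<^sub>R (g s x *\<^sub>R f (x + s *\<^sub>R w))) \<in> borel_measurable (lborel \<Otimes>\<^sub>M lborel)"
    by measurable
  have "norm (indicator {0..1::real} s *\<^sub>R (g s x *\<^sub>R f (x + s *\<^sub>R w)))
      \<le> norm (M *\<^sub>R (indicator {0..1::real} s *\<^sub>R ?f (x + s *\<^sub>R w)))" for s x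
  proof (cases "s \<in> {0..1} \<and> x \<in> K")
    case True
    then have "x + s *\<^sub>R w \<in> sweep w K" by (intro in_sweep) auto
    with True gM[of s x] show ?thesis by (auto intro!: mult_right_mono)
  next
    case False
    then show ?thesis using g0[of s x] by (auto simp: indicator_def)
  qed
  then show "AE z in lborel \<Otimes>\<^sub>M lborel.
     norm (case z of (s, x) \<Rightarrow> indicator {0..1::real} s *\<^sub>R (g s x *\<^sub>R f (x + s *\<^sub>R w)))
     \<le> norm (M *\<^sub>R (case z of (s, x) \<Rightarrow> indicator {0..1::real} s *\<^sub>R ?f (x + s *\<^sub>R w)))"
    by (intro AE_I2) (simp only: split_beta')
qed

lemma loc_int_translate:
  fixes f :: "'a::euclidean_space \<Rightarrow> 'b::euclidean_space"
  assumes f: "loc_int f" shows "loc_int (\<lambda>x. f (x + w))"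
  unfolding loc_int_def
proof (intro conjI allI impI)
  note [measurable] = loc_int_measurable[OF f]
  show "(\<lambda>x. f (x + w)) \<in> borel_measurable borel" by measurable
  fix K :: "'a set" assume K: "compact K"
  let ?K = "(+) w ` K"
  have K': "compact ?K" using K by (rule compact_translation)
  then have [measurable]: "?K \<in> sets borel" by (rule borel_compact)
  have "integrable lborel (\<lambda>x. indicator ?K (x + w) *\<^sub>R f (x + w))"
    using loc_int_integrable[OF f K'] 
    by (subst integrable_lborel_translate[of "\<lambda>x. indicator ?K x *\<^sub>R f x"]) auto
  also have "(\<lambda>x. indicator ?K (x + w) *\<^sub>R f (x + w)) = (\<lambda>x. indicator K x *\<^sub>R f (x + w))"
    by (auto simp: indicator_def fun_eq_iff add.commute)
  finally show "integrable lborel (\<lambda>x. indicator K x *\<^sub>R f (x + w))" .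
qed

lemma loc_int_average:
  fixes f :: "'a::euclidean_space \<Rightarrow> 'b::euclidean_space"
  assumes f: "loc_int f"
  shows "loc_int (\<lambda>x. LINT s|lborel. indicator {0..1::real} s *\<^sub>R f (x + s *\<^sub>R w))"
  unfolding loc_int_def
proof (intro conjI allI impI)
  note [measurable] = loc_int_measurable[OF f]
  show "(\<lambda>x. LINT s|lborel. indicator {0..1::real} s *\<^sub>R f (x + s *\<^sub>R w)) \<in> borel_measurable borel" by measurable
  fix K :: "'a set" assume K: "compact K"
  have [measurable]: "K \<in> sets borel" using K by (rule borel_compact)
  have "integrable (lborel \<Otimes>\<^sub>M lborel)
    (\<lambda>(s, x). indicator {0..1::real} s *\<^sub>R ((indicator K x :: real) *\<^sub>R f (x + s *\<^sub>R w)))"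
    by (rule product_integrable_loc_int[OF f K, where M=1]) (auto simp: indicator_def)
  from lborel_pair.integrable_snd[OF this]
  show "integrable lborel (\<lambda>x. indicator K x *\<^sub>R (LINT s|lborel. indicator {0..1::real} s *\<^sub>R f (x + s *\<^sub>R w)))"
    by (rule Bochner_Integration.integrable_cong[THEN iffD1, rotated 2]) (auto simp: indicator_def)
qed

text \<open>Tested against \<open>\<phi>\<close>, the increment of \<psi> becomes an increment of
  \<open>\<phi>\<close>, hence an integral over \<open>s\<close> of derivatives of shifted test
  functions. Fubini, the weak derivative for each fixed \<open>s\<close>, and the shift back produce
  the average of \<open>f\<close>; the fundamental lemma concludes.\<close>

lemma weak_deriv_increment:
  fixes \<psi> :: "'a::euclidean_space \<Rightarrow> 'b::euclidean_space"
  assumes wd: "weak_deriv w \<psi> f"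
  shows "AE x in lborel. \<psi> (x + w) - \<psi> x = (LINT s|lborel. indicator {0..1::real} s *\<^sub>R f (x + s *\<^sub>R w))"
proof -
  let ?avg = "\<lambda>x. LINT s|lborel. indicator {0..1::real} s *\<^sub>R f (x + s *\<^sub>R w)"
  have li: "loc_int \<psi>" "loc_int f" using wd by (auto simp: weak_deriv_def)
  note [measurable] = li[THEN loc_int_measurable]
  have d: "loc_int (\<lambda>x. \<psi> (x + w) - \<psi> x)"
    by (intro loc_int_diff loc_int_translate li)
  have v: "loc_int (\<lambda>x. \<psi> (x + w) - \<psi> x - ?avg x)"
    by (intro d loc_int_diff loc_int_average li)
  have "(LINT x|lborel. \<phi> x *\<^sub>R (\<psi> (x + w) - \<psi> x - ?avg x)) = 0" if \<phi>: "\<phi> \<in> test_functions" for \<phi>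
  proof -
    obtain K M where K: "compact K" "\<And>x. x \<notin> K \<Longrightarrow> \<phi> x = 0"
      "\<And>x. x \<notin> K \<Longrightarrow> frechet_derivative \<phi> (at x) w = 0"
      and M: "\<And>x. \<bar>\<phi> x\<bar> \<le> M" "\<And>x. \<bar>frechet_derivative \<phi> (at x) w\<bar> \<le> M"
      using test_function_bounds[OF \<phi>, of w] by metis
    let ?D = "\<lambda>x. frechet_derivative \<phi> (at x) w"
    let ?i = "\<lambda>s. indicator {0..1::real} s :: real"
    have [measurable]: "\<phi> \<in> borel_measurable borel" "?D \<in> borel_measurable borel"
      using \<phi> by (auto intro!: borel_measurable_continuous_onI test_function_continuous test_function_deriv_continuous)
    have shift: "(\<lambda>x. \<phi> (x - t *\<^sub>R w)) \<in> test_functions" for t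
      using test_functions_affine[OF \<phi>, of 1 "- t *\<^sub>R w"] by simp
    have shift_D: "frechet_derivative (\<lambda>x. \<phi> (x - t *\<^sub>R w)) (at x) w = ?D (x - t *\<^sub>R w)" for t x
      using frechet_derivative_affine[OF test_function_differentiable[OF \<phi>], of 1 "- t *\<^sub>R w" x]
      by (intro frechet_derivative_apply) simp
    have P1: "integrable (lborel \<Otimes>\<^sub>M lborel) (\<lambda>(s, x). ?i s *\<^sub>R (?D (x - s *\<^sub>R w) *\<^sub>R \<psi> x))"
    proof -
      have "?D (x - s *\<^sub>R w) = 0" if "0 \<le> s" "s \<le> 1" "x \<notin> sweep w K" for s x
      proof (rule K(3))
        show "x - s *\<^sub>R w \<notin> K" using that in_sweep[of "x - s *\<^sub>R w" K s w] by auto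
      qed
      \<comment> \<open>Here the shift sits in the weight and not in \<psi>, so the general lemma is
        used with direction 0 and with the swept support.\<close>
      then have "integrable (lborel \<Otimes>\<^sub>M lborel) (\<lambda>(s, x). ?i s *\<^sub>R (?D (x - s *\<^sub>R w) *\<^sub>R \<psi> (x + s *\<^sub>R 0)))"
        by (intro product_integrable_loc_int[OF li(1) compact_sweep[OF K(1)] _ _ M(2)]) auto
      then show ?thesis by simp
    qed
    have P2: "integrable (lborel \<Otimes>\<^sub>M lborel) (\<lambda>(s, x). ?i s *\<^sub>R (\<phi> x *\<^sub>R f (x + s *\<^sub>R w)))"
      by (rule product_integrable_loc_int[OF li(2) K(1) _ _ M(1)]) (auto simp: K)
    have "(LINT x|lborel. \<phi> x *\<^sub>R (\<psi> (x + w) - \<psi> x))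
        = (LINT x|lborel. \<phi> x *\<^sub>R \<psi> (x + w)) - (LINT x|lborel. \<phi> x *\<^sub>R \<psi> x)"
      unfolding scaleR_diff_right
      by (intro Bochner_Integration.integral_diff test_function_integrable \<phi> loc_int_translate li)
    also have "(LINT x|lborel. \<phi> x *\<^sub>R \<psi> (x + w)) = (LINT x|lborel. \<phi> (x - 1 *\<^sub>R w) *\<^sub>R \<psi> x)"
      using integral_lborel_translate[of "\<lambda>x. \<phi> (x - w) *\<^sub>R \<psi> x" w] by simp
    also have "\<dots> - (LINT x|lborel. \<phi> x *\<^sub>R \<psi> x) = (LINT x|lborel. (\<phi> (x - w) - \<phi> x) *\<^sub>R \<psi> x)"
      using test_function_integrable[OF li(1) shift[of 1]] test_function_integrable[OF li(1) \<phi>]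
      by (simp add: scaleR_diff_left)
    also have "\<dots> = (LINT x|lborel. - (LINT s|lborel. ?i s *\<^sub>R (?D (x - s *\<^sub>R w) *\<^sub>R \<psi> x)))"
    proof (rule Bochner_Integration.integral_cong[OF refl])
      fix x
      have "integrable lborel (\<lambda>s. ?i s *\<^sub>R ?D (x - s *\<^sub>R w))"
        by (intro borel_integrable_compact continuous_on_compose2[OF test_function_deriv_continuous[OF \<phi>]]
              continuous_intros) auto
      then show "(\<phi> (x - w) - \<phi> x) *\<^sub>R \<psi> x = - (LINT s|lborel. ?i s *\<^sub>R (?D (x - s *\<^sub>R w) *\<^sub>R \<psi> x))"
        using integral_scaleR_left[where M=lborel and f="\<lambda>s. ?i s *\<^sub>R ?D (x - s *\<^sub>R w)" and c="\<psi> x"]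
        by (simp add: test_function_increment[OF \<phi>])
    qed
    also have "\<dots> = - (LINT s|lborel. LINT x|lborel. ?i s *\<^sub>R (?D (x - s *\<^sub>R w) *\<^sub>R \<psi> x))"
      by (simp only: Bochner_Integration.integral_minus lborel_pair.Fubini_integral[OF P1])
    also have "\<dots> = (LINT s|lborel. ?i s *\<^sub>R - (LINT x|lborel. ?D (x - s *\<^sub>R w) *\<^sub>R \<psi> x))"
      by (simp only: integral_scaleR_right scaleR_minus_right Bochner_Integration.integral_minus)
    \<comment> \<open>For each \<open>s\<close> the shifted \<open>\<phi>\<close> is again a test
      function, so the definition of the weak derivative applies to it.\<close>
    also have "\<dots> = (LINT s|lborel. ?i s *\<^sub>R (LINT x|lborel. \<phi> (x - s *\<^sub>R w) *\<^sub>R f x))"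
      using wd shift by (simp add: weak_deriv_def shift_D[symmetric])
    also have "\<dots> = (LINT s|lborel. LINT x|lborel. ?i s *\<^sub>R (\<phi> x *\<^sub>R f (x + s *\<^sub>R w)))"
    proof (rule Bochner_Integration.integral_cong[OF refl])
      fix s
      show "?i s *\<^sub>R (LINT x|lborel. \<phi> (x - s *\<^sub>R w) *\<^sub>R f x) = (LINT x|lborel. ?i s *\<^sub>R (\<phi> x *\<^sub>R f (x + s *\<^sub>R w)))"
        using integral_lborel_translate[of "\<lambda>x. \<phi> (x - s *\<^sub>R w) *\<^sub>R f x" "s *\<^sub>R w"]
        by (simp add: integral_scaleR_right del: scaleR_scaleR)
    qed
    also have "\<dots> = (LINT x|lborel. LINT s|lborel. ?i s *\<^sub>R (\<phi> x *\<^sub>R f (x + s *\<^sub>R w)))"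
      by (simp only: lborel_pair.Fubini_integral[OF P2])
    also have "\<dots> = (LINT x|lborel. \<phi> x *\<^sub>R ?avg x)"
      by (simp only: integral_scaleR_right scaleR_left_commute)
    finally have "(LINT x|lborel. \<phi> x *\<^sub>R (\<psi> (x + w) - \<psi> x)) = (LINT x|lborel. \<phi> x *\<^sub>R ?avg x)" .
    then show ?thesis
      using test_function_integrable[OF d \<phi>] test_function_integrable[OF loc_int_average[OF li(2)] \<phi>]
      by (subst scaleR_diff_right) (simp only: Bochner_Integration.integral_diff diff_self)
  qed
  from fundamental_lemma_calculus_of_variations[OF v this] show ?thesis by simp
qed

text \<open>The quotient is the mean of \<open>f\<close> over the segment from \<open>x\<close> to
  \<open>x + h n w\<close>, so its error in \<open>L^1(K)\<close> is at most the mean over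
  \<open>s\<close> of the \<open>L^1\<close> distance between \<open>f\<close> and its shift by
  \<open>s h n w\<close>. This tends to 0 for each \<open>s\<close>, and twice the norm of the
  truncated \<open>f\<close> dominates.\<close>

lemma difference_quotient_tendsto:
  fixes \<psi> :: "'a::euclidean_space \<Rightarrow> 'b::euclidean_space"
  assumes wd: "weak_deriv w \<psi> f" and h: "h \<longlonglongrightarrow> 0" "\<And>n. h n \<noteq> 0" and K: "compact K"
  shows "(\<lambda>n. LINT x|lborel. indicator K x * norm ((\<psi> (x + h n *\<^sub>R w) - \<psi> x) /\<^sub>R h n - f x)) \<longlonglongrightarrow> 0"
proof -
  have li: "loc_int \<psi>" "loc_int f" using wd by (auto simp: weak_deriv_def)
  note [measurable] = li[THEN loc_int_measurable] borel_compact[OF K]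
  define K' where "K' = sweep w K"
  \<comment> \<open>Translation continuity needs a globally integrable function; \<open>F\<close>
    agrees with \<open>f\<close> at every point reached from \<open>K\<close> by a step of size at
    most 1.\<close>
  define F where "F = (\<lambda>x. indicator K' x *\<^sub>R f x)"
  have F: "integrable lborel F"
    unfolding F_def K'_def by (intro loc_int_integrable li compact_sweep K)
  then have [measurable]: "F \<in> borel_measurable borel" by auto
  let ?i = "\<lambda>s. indicator {0..1::real} s :: real"
  let ?T = "\<lambda>t. LINT x|lborel. norm (F (x + t) - F x)"
  have prod: "integrable (lborel \<Otimes>\<^sub>M lborel) (\<lambda>(s, x). ?i s *\<^sub>R norm (F (x + s *\<^sub>R (t *\<^sub>R w)) - F x))" for t
  proof -
    have "integrable (lborel \<Otimes>\<^sub>M lborel) (\<lambda>z. norm ((case z of (s, x) \<Rightarrow> ?i s *\<^sub>R F (x + s *\<^sub>R (t *\<^sub>R w)))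
       - (case z of (s, x) \<Rightarrow> ?i s *\<^sub>R F (x + s *\<^sub>R 0))))"
      by (intro integrable_norm Bochner_Integration.integrable_diff product_integrable_translate F)
    then show ?thesis
      by (simp add: split_beta' flip: scaleR_diff_right)
  qed
  have T_bound: "?T t \<le> 2 * (LINT x|lborel. norm (F x))" for t
  proof -
    have "?T t \<le> (LINT x|lborel. norm (F (x + t)) + norm (F x))"
      using F by (intro integral_mono integrable_norm Bochner_Integration.integrable_diff Bochner_Integration.integrable_add)
        (auto simp: integrable_lborel_translate norm_triangle_ineq4)
    also have "\<dots> = 2 * (LINT x|lborel. norm (F x))"
      using F integral_lborel_translate[of "\<lambda>x. norm (F x)" t]
      by (simp add: integrable_lborel_translate)
    finally show ?thesis .
  qed
  have lim: "(\<lambda>n. LINT s|lborel. ?i s * ?T (s *\<^sub>R (h n *\<^sub>R w))) \<longlonglongrightarrow> (LINT s|(lborel::real measure). 0)"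
  proof (rule integral_dominated_convergence[where w="\<lambda>s. ?i s * (2 * (LINT x|lborel. norm (F x)))"])
    show "(\<lambda>s. ?i s * ?T (s *\<^sub>R (h n *\<^sub>R w))) \<in> borel_measurable lborel" for n by measurable
    show "integrable lborel (\<lambda>s. ?i s * (2 * (LINT x|lborel. norm (F x))))" by simp
    show "AE s in lborel. norm (?i s * ?T (s *\<^sub>R (h n *\<^sub>R w))) \<le> ?i s * (2 * (LINT x|lborel. norm (F x)))" for n
      using T_bound by (intro AE_I2) (auto simp: indicator_def integral_nonneg)
    have "(\<lambda>n. ?i s * ?T (s *\<^sub>R (h n *\<^sub>R w))) \<longlonglongrightarrow> ?i s * 0" for s
    proof (intro tendsto_intros L1_translation_continuous F)
      have "(\<lambda>n. s *\<^sub>R (h n *\<^sub>R w)) \<longlonglongrightarrow> s *\<^sub>R (0 *\<^sub>R w)" by (intro tendsto_intros h)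
      then show "(\<lambda>n. s *\<^sub>R (h n *\<^sub>R w)) \<longlonglongrightarrow> 0" by simp
    qed
    then show "AE s in lborel. (\<lambda>n. ?i s * ?T (s *\<^sub>R (h n *\<^sub>R w))) \<longlonglongrightarrow> 0" by simp
  qed auto
  have le: "(LINT x|lborel. indicator K x * norm ((\<psi> (x + t *\<^sub>R w) - \<psi> x) /\<^sub>R t - f x))
      \<le> (LINT s|lborel. ?i s * ?T (s *\<^sub>R (t *\<^sub>R w)))" if t: "\<bar>t\<bar> \<le> 1" "t \<noteq> 0" for t
  proof -
    let ?q = "\<lambda>x. (\<psi> (x + t *\<^sub>R w) - \<psi> x) /\<^sub>R t - f x"
    \<comment> \<open>The increment formula is applied in the direction \<open>t w\<close>, whose
      weak derivative is \<open>t f\<close>; dividing by \<open>t\<close> leaves the mean of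
      \<open>f\<close>.\<close>
    have "AE x in lborel. \<psi> (x + t *\<^sub>R w) - \<psi> x = (LINT s|lborel. ?i s *\<^sub>R (t *\<^sub>R f (x + s *\<^sub>R (t *\<^sub>R w))))"
      by (rule weak_deriv_increment[OF weak_deriv_scale[OF wd]])
    moreover have "AE x in lborel. integrable lborel (\<lambda>s. ?i s *\<^sub>R F (x + s *\<^sub>R (t *\<^sub>R w)))"
      by (rule lborel_pair.AE_integrable_snd[OF product_integrable_translate[OF F]])
    ultimately have ae: "AE x in lborel. indicator K x * norm (?q x)
        \<le> (LINT s|lborel. ?i s *\<^sub>R norm (F (x + s *\<^sub>R (t *\<^sub>R w)) - F x))"
    proof eventually_elim
      case (elim x)
      show ?case
      proof (cases "x \<in> K")
        case False
        then show ?thesis by (simp add: integral_nonneg)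
      next
        case True
        have fF: "F (x + s *\<^sub>R (t *\<^sub>R w)) = f (x + s *\<^sub>R (t *\<^sub>R w))" if "s \<in> {0..1}" for s
        proof -
          have "\<bar>s * t\<bar> \<le> 1" using t that by (simp add: abs_mult mult_le_one)
          from in_sweep[OF True this, of w] show ?thesis by (simp add: F_def K'_def)
        qed
        have fF0: "F x = f x" using in_sweep[OF True, of 0 w] by (simp add: F_def K'_def)
        have "?q x = (LINT s|lborel. ?i s *\<^sub>R F (x + s *\<^sub>R (t *\<^sub>R w))) - F x"
        proof -
          have "(LINT s|lborel. ?i s *\<^sub>R (t *\<^sub>R f (x + s *\<^sub>R (t *\<^sub>R w)))) = (LINT s|lborel. t *\<^sub>R (?i s *\<^sub>R F (x + s *\<^sub>R (t *\<^sub>R w))))"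
            using fF by (intro Bochner_Integration.integral_cong) (auto simp: indicator_def)
          also have "\<dots> = t *\<^sub>R (LINT s|lborel. ?i s *\<^sub>R F (x + s *\<^sub>R (t *\<^sub>R w)))"
            by (rule integral_scaleR_right)
          finally have "\<psi> (x + t *\<^sub>R w) - \<psi> x = t *\<^sub>R (LINT s|lborel. ?i s *\<^sub>R F (x + s *\<^sub>R (t *\<^sub>R w)))"
            by (simp only: elim(1))
          with t fF0 show ?thesis by simp
        qed
        also have "\<dots> = (LINT s|lborel. ?i s *\<^sub>R (F (x + s *\<^sub>R (t *\<^sub>R w)) - F x))"
          using elim(2) by (simp add: scaleR_diff_right)
        finally have q: "?q x = (LINT s|lborel. ?i s *\<^sub>R (F (x + s *\<^sub>R (t *\<^sub>R w)) - F x))" .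
        have "norm (?q x) \<le> (LINT s|lborel. norm (?i s *\<^sub>R (F (x + s *\<^sub>R (t *\<^sub>R w)) - F x)))"
          by (subst q) (rule integral_norm_bound)
        with True show ?thesis by simp
      qed
    qed
    have "(LINT x|lborel. indicator K x * norm (?q x))
        \<le> (LINT x|lborel. LINT s|lborel. ?i s *\<^sub>R norm (F (x + s *\<^sub>R (t *\<^sub>R w)) - F x))"
    proof (rule integral_mono_AE[OF _ lborel_pair.integrable_snd[OF prod] ae])
      have "loc_int ?q"
        by (intro loc_int_diff loc_int_scaleR loc_int_translate li)
      from integrable_norm[OF loc_int_integrable[OF this K]]
      show "integrable lborel (\<lambda>x. indicator K x * norm (?q x))"
        by (simp only: norm_scaleR abs_indicator)
    qed
    also have "\<dots> = (LINT s|lborel. LINT x|lborel. ?i s *\<^sub>R norm (F (x + s *\<^sub>R (t *\<^sub>R w)) - F x))"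
      by (rule lborel_pair.Fubini_integral[OF prod])
    finally show ?thesis by simp
  qed
  show ?thesis
  proof (rule tendsto_sandwich[OF _ _ tendsto_const])
    show "(\<lambda>n. LINT s|lborel. ?i s * ?T (s *\<^sub>R (h n *\<^sub>R w))) \<longlonglongrightarrow> 0" using lim by simp
    have "eventually (\<lambda>n. \<bar>h n\<bar> < 1) sequentially"
      using h(1) tendsto_rabs_zero order_tendstoD(2) zero_less_one by metis
    then show "\<forall>\<^sub>F n in sequentially. (LINT x|lborel. indicator K x * norm ((\<psi> (x + h n *\<^sub>R w) - \<psi> x) /\<^sub>R h n - f x))
        \<le> (LINT s|lborel. ?i s * ?T (s *\<^sub>R (h n *\<^sub>R w)))"
      by eventually_elim (intro le, auto simp: h)
  qed (auto intro!: always_eventually integral_nonneg)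
qed

section \<open>The weak derivative of the modulus\<close>

text \<open>The directional derivative of the modulus at \<open>z\<close> along \<open>v\<close>,
  with the value of the symmetric derivative at the non-smooth point \<open>z = 0\<close>.\<close>

definition cmod_deriv :: "complex \<Rightarrow> complex \<Rightarrow> real" where
  "cmod_deriv z v = (if z = 0 then 0 else Re (cnj z * v) / cmod z)"

lemma abs_cmod_deriv_le: "\<bar>cmod_deriv z v\<bar> \<le> cmod v"
proof (cases "z = 0")
  case False
  have "\<bar>Re (cnj z * v)\<bar> \<le> cmod z * cmod v"
    by (metis abs_Re_le_cmod complex_mod_cnj norm_mult)
  with False show ?thesis by (simp add: cmod_deriv_def field_simps)
qed (simp add: cmod_deriv_def)

lemma borel_measurable_cmod_deriv [measurable]:
  assumes [measurable]: "f \<in> borel_measurable M" "g \<in> borel_measurable M"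
  shows "(\<lambda>x. cmod_deriv (f x) (g x)) \<in> borel_measurable M"
proof -
  have "(\<lambda>x. cmod_deriv (f x) (g x)) =
      (\<lambda>x. if f x = 0 then 0 else (Re (f x) * Re (g x) + Im (f x) * Im (g x)) / cmod (f x))"
    by (auto simp: cmod_deriv_def fun_eq_iff)
  also have "\<dots> \<in> borel_measurable M" by measurable
  finally show ?thesis .
qed

text \<open>At \<open>z = 0\<close> the two moduli are equal and every quotient is 0. Otherwise the
  numerator is multiplied by the sum of the moduli: the difference of squares is
  \<open>4 h Re (cnj z * v)\<close>, and the sum tends to \<open>2 * cmod z\<close>.\<close>

lemma cmod_symmetric_quotient_tendsto:
  assumes h: "h \<longlonglongrightarrow> 0" "\<And>n. h n \<noteq> (0::real)"
  shows "(\<lambda>n. (cmod (z + h n *\<^sub>R v) - cmod (z - h n *\<^sub>R v)) / (2 * h n)) \<longlonglongrightarrow> cmod_deriv z v"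
proof (cases "z = 0")
  case True
  then show ?thesis by (simp add: cmod_deriv_def)
next
  case False
  have "(\<lambda>n. cmod (z + h n *\<^sub>R v) + cmod (z - h n *\<^sub>R v)) \<longlonglongrightarrow> cmod (z + 0 *\<^sub>R v) + cmod (z - 0 *\<^sub>R v)"
    by (intro tendsto_intros h)
  then have lim: "(\<lambda>n. cmod (z + h n *\<^sub>R v) + cmod (z - h n *\<^sub>R v)) \<longlonglongrightarrow> 2 * cmod z" by simp
  then have "(\<lambda>n. 2 * Re (cnj z * v) / (cmod (z + h n *\<^sub>R v) + cmod (z - h n *\<^sub>R v)))
      \<longlonglongrightarrow> 2 * Re (cnj z * v) / (2 * cmod z)"
    using False by (intro tendsto_intros) auto
  moreover have "2 * Re (cnj z * v) / (2 * cmod z) = cmod_deriv z v"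
    using False by (simp add: cmod_deriv_def field_simps)
  ultimately have "(\<lambda>n. 2 * Re (cnj z * v) / (cmod (z + h n *\<^sub>R v) + cmod (z - h n *\<^sub>R v))) \<longlonglongrightarrow> cmod_deriv z v"
    by (simp only:)
  moreover have "eventually (\<lambda>n. cmod (z + h n *\<^sub>R v) + cmod (z - h n *\<^sub>R v) > 0) sequentially"
    using lim False by (intro order_tendstoD) auto
  then have "eventually (\<lambda>n. 2 * Re (cnj z * v) / (cmod (z + h n *\<^sub>R v) + cmod (z - h n *\<^sub>R v))
     = (cmod (z + h n *\<^sub>R v) - cmod (z - h n *\<^sub>R v)) / (2 * h n)) sequentially"
  proof eventually_elim
    case (elim n)
    have "(cmod (z + h n *\<^sub>R v) - cmod (z - h n *\<^sub>R v)) * (cmod (z + h n *\<^sub>R v) + cmod (z - h n *\<^sub>R v))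
      = (cmod (z + h n *\<^sub>R v))\<^sup>2 - (cmod (z - h n *\<^sub>R v))\<^sup>2"
      by (simp add: algebra_simps power2_eq_square)
    also have "\<dots> = 4 * h n * Re (cnj z * v)"
      unfolding cmod_power2 by (simp add: power2_eq_square algebra_simps)
    finally show ?case using elim h(2)[of n] by (simp add: field_simps)
  qed
  ultimately show ?thesis by (rule Lim_transform_eventually)
qed

lemma test_function_quotient_tendsto:
  assumes \<phi>: "\<phi> \<in> test_functions" and h: "h \<longlonglongrightarrow> 0" "\<And>n. h n \<noteq> (0::real)"
  shows "(\<lambda>n. (\<phi> (x + h n *\<^sub>R w) - \<phi> x) / h n) \<longlonglongrightarrow> frechet_derivative \<phi> (at x) w"
proof -
  have "((\<lambda>s. \<phi> (x + s *\<^sub>R w)) has_derivative (\<lambda>s. frechet_derivative \<phi> (at (x + 0 *\<^sub>R w)) (s *\<^sub>R w))) (at 0)"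
    by (rule has_derivative_compose[where f="\<lambda>s. x + s *\<^sub>R w" and g=\<phi>, OF _ test_function_has_derivative[OF \<phi>]])
       (auto intro!: derivative_eq_intros)
  then have "((\<lambda>s. \<phi> (x + s *\<^sub>R w)) has_real_derivative frechet_derivative \<phi> (at x) w) (at 0)"
    by (rule has_derivative_imp_has_field_derivative) (simp add: test_function_deriv_scale[OF \<phi>])
  then have "((\<lambda>s. (\<phi> (x + s *\<^sub>R w) - \<phi> x) / s) \<longlongrightarrow> frechet_derivative \<phi> (at x) w) (at 0)"
    by (simp add: DERIV_def)
  then show ?thesis
    by (rule filterlim_compose) (use h in \<open>auto simp: filterlim_at\<close>)
qed

lemma test_function_lipschitz:
  assumes \<phi>: "\<phi> \<in> test_functions" and M: "\<And>x. \<bar>frechet_derivative \<phi> (at x) w\<bar> \<le> M"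
  shows "\<bar>\<phi> (x + h *\<^sub>R w) - \<phi> x\<bar> \<le> \<bar>h\<bar> * M"
proof -
  have "norm (\<phi> (x + h *\<^sub>R w) - \<phi> (x + 0 *\<^sub>R w)) \<le> M * norm (h - 0)"
  proof (rule field_differentiable_bound[where S=UNIV and f'="\<lambda>s. frechet_derivative \<phi> (at (x + s *\<^sub>R w)) w"])
    fix s :: real
    have "((\<lambda>s. \<phi> (x + s *\<^sub>R w)) has_derivative (\<lambda>t. frechet_derivative \<phi> (at (x + s *\<^sub>R w)) (t *\<^sub>R w))) (at s)"
      by (rule has_derivative_compose[where f="\<lambda>s. x + s *\<^sub>R w" and g=\<phi>, OF _ test_function_has_derivative[OF \<phi>]])
         (auto intro!: derivative_eq_intros)
    then show "((\<lambda>s. \<phi> (x + s *\<^sub>R w)) has_field_derivative frechet_derivative \<phi> (at (x + s *\<^sub>R w)) w) (at s within UNIV)"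
      by (intro has_derivative_imp_has_field_derivative[OF has_derivative_at_withinI])
         (simp_all add: test_function_deriv_scale[OF \<phi>])
  qed (use M in auto)
  then show ?thesis by (simp add: mult.commute)
qed

text \<open>The two hypotheses are the errors at the steps \<open>t\<close> and \<open>- t\<close>;
  a symmetric quotient averages them.\<close>

lemma quotient_diff_le:
  fixes a b c d t \<alpha> \<beta> :: real
  assumes "0 < t" "\<bar>a - b\<bar> \<le> \<bar>t\<bar> * \<alpha>" "\<bar>c - d\<bar> \<le> \<bar>- t\<bar> * \<beta>"
  shows "\<bar>(a - c) / (2 * t) - (b - d) / (2 * t)\<bar> \<le> (\<alpha> + \<beta>) / 2"
proof -
  have "\<bar>(a - c) - (b - d)\<bar> \<le> t * (\<alpha> + \<beta>)"
    using assms by (simp add: algebra_simps)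
  then have "\<bar>(a - c) - (b - d)\<bar> / (2 * t) \<le> t * (\<alpha> + \<beta>) / (2 * t)"
    using assms(1) by (intro divide_right_mono) auto
  then show ?thesis using assms(1) by (simp add: diff_divide_distrib[symmetric])
qed

text \<open>The symmetric quotients \<open>?Q\<close> of the modulus are compared with the quotients
  \<open>?R\<close> in which \<psi> is replaced by its linearisation
  \<open>\<psi> x \<plusminus> h f x\<close>. Since the modulus is 1-Lipschitz, their difference is
  controlled by the \<open>L^1_loc\<close> error of the difference quotients of \<psi>, while
  \<open>?R\<close> converges pointwise and is dominated by \<open>cmod (f x)\<close>. Thus no
  pointwise convergence of the quotients of \<psi> enters.\<close>

lemma weak_deriv_cmod:
  fixes \<psi> :: "'a::euclidean_space \<Rightarrow> complex"
  assumes wd: "weak_deriv w \<psi> f"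
  shows "weak_deriv w (\<lambda>x. cmod (\<psi> x)) (\<lambda>x. cmod_deriv (\<psi> x) (f x))"
  unfolding weak_deriv_def
proof (intro conjI ballI)
  let ?g = "\<lambda>x. cmod_deriv (\<psi> x) (f x)"
  have li: "loc_int \<psi>" "loc_int f" using wd by (auto simp: weak_deriv_def)
  note [measurable] = li[THEN loc_int_measurable]
  show lc: "loc_int (\<lambda>x. cmod (\<psi> x))" by (rule loc_int_bound[OF li(1)]) auto
  show lg: "loc_int ?g" by (rule loc_int_bound[OF li(2)]) (auto simp: abs_cmod_deriv_le)
  fix \<phi> :: "'a \<Rightarrow> real" assume \<phi>: "\<phi> \<in> test_functions"
  obtain K M where K: "compact K" "\<And>x. x \<notin> K \<Longrightarrow> \<phi> x = 0"
    and M: "0 \<le> M" "\<And>x. \<bar>\<phi> x\<bar> \<le> M" "\<And>x. \<bar>frechet_derivative \<phi> (at x) w\<bar> \<le> M"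
    using test_function_bounds[OF \<phi>, of w] by metis
  let ?D = "\<lambda>x. frechet_derivative \<phi> (at x) w"
  define h where "h = (\<lambda>n. inverse (real (Suc n)))"
  have h: "h \<longlonglongrightarrow> 0" "\<And>n. h n \<noteq> 0" "\<And>n. 0 < h n" "\<And>n. h n \<le> 1"
    unfolding h_def by (rule LIMSEQ_inverse_real_of_nat) (simp_all add: inverse_le_1_iff)
  have mh: "(\<lambda>n. - h n) \<longlonglongrightarrow> 0" using tendsto_minus[OF h(1)] by simp
  have [measurable]: "\<phi> \<in> borel_measurable borel" "?D \<in> borel_measurable borel"
    using \<phi> by (auto intro!: borel_measurable_continuous_onI test_function_continuous test_function_deriv_continuous)
  note [measurable] = borel_compact[OF K(1)]
  let ?Q = "\<lambda>n x. (cmod (\<psi> (x + h n *\<^sub>R w)) - cmod (\<psi> (x - h n *\<^sub>R w))) / (2 * h n)"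
  let ?R = "\<lambda>n x. (cmod (\<psi> x + h n *\<^sub>R f x) - cmod (\<psi> x - h n *\<^sub>R f x)) / (2 * h n)"
  let ?\<phi> = "\<lambda>n x. (\<phi> (x + h n *\<^sub>R w) - \<phi> (x - h n *\<^sub>R w)) / (2 * h n)"

  have lc_shift: "loc_int (\<lambda>x. cmod (\<psi> (x + t *\<^sub>R w)))" for t
    using loc_int_translate[OF lc] .
  have shift: "(\<lambda>x. \<phi> (x + t *\<^sub>R w)) \<in> test_functions" for t
    using test_functions_affine[OF \<phi>, of 1 "t *\<^sub>R w"] by simp
  have lQ: "loc_int (?Q n)" for n
    using loc_int_scaleR[OF loc_int_diff[OF lc_shift[of "h n"] lc_shift[of "- h n"]], of "1 / (2 * h n)"]
    by simp
  have R_le: "\<bar>?R n x\<bar> \<le> cmod (f x)" for n x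
  proof -
    have "\<bar>cmod (\<psi> x + h n *\<^sub>R f x) - cmod (\<psi> x - h n *\<^sub>R f x)\<bar> \<le> cmod ((\<psi> x + h n *\<^sub>R f x) - (\<psi> x - h n *\<^sub>R f x))"
      by (rule norm_triangle_ineq3)
    also have "(\<psi> x + h n *\<^sub>R f x) - (\<psi> x - h n *\<^sub>R f x) = (2 * h n) *\<^sub>R f x"
      unfolding mult_2 scaleR_left_distrib by simp
    finally show ?thesis using h(3)[of n] by (simp add: field_simps)
  qed
  have lR: "loc_int (?R n)" for n
    by (rule loc_int_bound[OF li(2)]) (use R_le in auto)

  \<comment> \<open>Quotients of the smooth \<open>\<phi>\<close> converge everywhere; the Lipschitz
    bound dominates them, and steps of size at most 1 keep their supports inside one sweep.\<close>
  have lim1: "(\<lambda>n. LINT x|lborel. ?\<phi> n x *\<^sub>R cmod (\<psi> x)) \<longlonglongrightarrow> (LINT x|lborel. ?D x *\<^sub>R cmod (\<psi> x))"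
  proof (rule integral_dominated_convergence[where w="\<lambda>x. M *\<^sub>R (indicator (sweep w K) x *\<^sub>R cmod (\<psi> x))"])
    show "integrable lborel (\<lambda>x. M *\<^sub>R (indicator (sweep w K) x *\<^sub>R cmod (\<psi> x)))"
      by (intro integrable_scaleR_right loc_int_integrable lc compact_sweep K)
    have "(\<lambda>n. ?\<phi> n x) \<longlonglongrightarrow> ?D x" for x
    proof -
      have "(\<lambda>n. 1/2 * ((\<phi> (x + h n *\<^sub>R w) - \<phi> x) / h n) + 1/2 * ((\<phi> (x + (- h n) *\<^sub>R w) - \<phi> x) / (- h n)))
         \<longlonglongrightarrow> 1/2 * ?D x + 1/2 * ?D x"
        using h by (intro tendsto_intros test_function_quotient_tendsto \<phi> mh) auto
      moreover have "1/2 * ((\<phi> (x + h n *\<^sub>R w) - \<phi> x) / h n) + 1/2 * ((\<phi> (x + (- h n) *\<^sub>R w) - \<phi> x) / (- h n)) = ?\<phi> n x" for n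
        using h(2)[of n] by (simp add: field_simps)
      ultimately show ?thesis by simp
    qed
    then show "AE x in lborel. (\<lambda>n. ?\<phi> n x *\<^sub>R cmod (\<psi> x)) \<longlonglongrightarrow> ?D x *\<^sub>R cmod (\<psi> x)"
      by (intro AE_I2 tendsto_intros)
    have "\<bar>?\<phi> n x\<bar> \<le> M * indicator (sweep w K) x" for n x
    proof (cases "x \<in> sweep w K")
      case False
      have "\<phi> (x + t *\<^sub>R w) = 0" if "\<bar>t\<bar> \<le> 1" for t
      proof (rule K(2))
        show "x + t *\<^sub>R w \<notin> K" using in_sweep[of "x + t *\<^sub>R w" K "- t" w] False that by auto
      qed
      from this[of "h n"] this[of "- h n"] h(3,4)[of n] M(1) show ?thesis by simp
    next
      case True
      have "\<bar>\<phi> (x + h n *\<^sub>R w) - \<phi> (x - h n *\<^sub>R w)\<bar> \<le> 2 * h n * M"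
        using test_function_lipschitz[OF \<phi> M(3), of x "h n"] test_function_lipschitz[OF \<phi> M(3), of x "- h n"] h(3)[of n]
        by (simp add: abs_le_iff)
      with True h(3)[of n] show ?thesis by (simp add: field_simps)
    qed
    from mult_right_mono[OF this norm_ge_zero]
    have "norm (?\<phi> n x *\<^sub>R cmod (\<psi> x)) \<le> M *\<^sub>R (indicator (sweep w K) x *\<^sub>R cmod (\<psi> x))" for n x
      by (simp add: abs_mult mult.assoc)
    then show "AE x in lborel. norm (?\<phi> n x *\<^sub>R cmod (\<psi> x)) \<le> M *\<^sub>R (indicator (sweep w K) x *\<^sub>R cmod (\<psi> x))" for n
      by (intro AE_I2)
  qed auto

  \<comment> \<open>Discrete integration by parts, exact for every \<open>n\<close> by translation
    invariance; the symmetric quotient changes only its sign.\<close>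
  have parts: "(LINT x|lborel. ?\<phi> n x *\<^sub>R cmod (\<psi> x)) = - (LINT x|lborel. \<phi> x *\<^sub>R ?Q n x)" for n
  proof -
    have i: "integrable lborel (\<lambda>x. \<phi> (x + s *\<^sub>R w) *\<^sub>R cmod (\<psi> (x + t *\<^sub>R w)))" for s t
      by (rule test_function_integrable[OF lc_shift shift])
    have eq: "(LINT x|lborel. \<phi> (x + t *\<^sub>R w) *\<^sub>R cmod (\<psi> x)) = (LINT x|lborel. \<phi> x *\<^sub>R cmod (\<psi> (x - t *\<^sub>R w)))" for t
      using integral_lborel_translate[of "\<lambda>x. \<phi> x *\<^sub>R cmod (\<psi> (x - t *\<^sub>R w))" "t *\<^sub>R w"] by simp
    have "(LINT x|lborel. ?\<phi> n x *\<^sub>R cmod (\<psi> x)) = (LINT x|lborel. (\<phi> (x + h n *\<^sub>R w) *\<^sub>R cmod (\<psi> x) - \<phi> (x + (- h n) *\<^sub>R w) *\<^sub>R cmod (\<psi> x)) / (2 * h n))"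
      by (intro Bochner_Integration.integral_cong) (auto simp: field_simps)
    also have "\<dots> = ((LINT x|lborel. \<phi> (x + h n *\<^sub>R w) *\<^sub>R cmod (\<psi> x)) - (LINT x|lborel. \<phi> (x + (- h n) *\<^sub>R w) *\<^sub>R cmod (\<psi> x))) / (2 * h n)"
      using i[of _ 0] by (simp only: integral_divide_zero Bochner_Integration.integral_diff scaleR_zero_left add_0_right)
    also have "\<dots> = ((LINT x|lborel. \<phi> x *\<^sub>R cmod (\<psi> (x + (- h n) *\<^sub>R w))) - (LINT x|lborel. \<phi> x *\<^sub>R cmod (\<psi> (x + h n *\<^sub>R w)))) / (2 * h n)"
      by (simp only: eq) simp
    also have "\<dots> = (LINT x|lborel. (\<phi> x *\<^sub>R cmod (\<psi> (x + (- h n) *\<^sub>R w)) - \<phi> x *\<^sub>R cmod (\<psi> (x + h n *\<^sub>R w))) / (2 * h n))"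
      using i[of 0] by (simp only: integral_divide_zero Bochner_Integration.integral_diff scaleR_zero_left add_0_right)
    also have "\<dots> = (LINT x|lborel. - (\<phi> x *\<^sub>R ?Q n x))"
      by (intro Bochner_Integration.integral_cong) (simp_all add: diff_divide_distrib right_diff_distrib)
    finally show ?thesis by simp
  qed

  have lim2: "(\<lambda>n. LINT x|lborel. \<phi> x *\<^sub>R ?R n x) \<longlonglongrightarrow> (LINT x|lborel. \<phi> x *\<^sub>R ?g x)"
  proof (rule integral_dominated_convergence[where w="\<lambda>x. norm (\<phi> x *\<^sub>R f x)"])
    show "integrable lborel (\<lambda>x. norm (\<phi> x *\<^sub>R f x))"
      by (intro integrable_norm test_function_integrable li \<phi>)
    show "AE x in lborel. (\<lambda>n. \<phi> x *\<^sub>R ?R n x) \<longlonglongrightarrow> \<phi> x *\<^sub>R ?g x"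
      by (intro AE_I2 tendsto_intros cmod_symmetric_quotient_tendsto h)
    have "norm (\<phi> x *\<^sub>R ?R n x) \<le> norm (\<phi> x *\<^sub>R f x)" for n x
      using mult_left_mono[OF R_le abs_ge_zero] by (simp only: norm_scaleR real_norm_def real_scaleR_def abs_mult)
    then show "AE x in lborel. norm (\<phi> x *\<^sub>R ?R n x) \<le> norm (\<phi> x *\<^sub>R f x)" for n by simp
  qed auto

  let ?d = "\<lambda>t x. indicator K x * cmod ((\<psi> (x + t *\<^sub>R w) - \<psi> x) /\<^sub>R t - f x)"
  have lim3: "(\<lambda>n. (LINT x|lborel. \<phi> x *\<^sub>R ?Q n x) - (LINT x|lborel. \<phi> x *\<^sub>R ?R n x)) \<longlonglongrightarrow> 0"
  proof (rule Lim_null_comparison)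
    have "(\<lambda>n. M / 2 * ((LINT x|lborel. ?d (h n) x) + (LINT x|lborel. ?d (- h n) x))) \<longlonglongrightarrow> M / 2 * (0 + 0)"
      using h by (intro tendsto_intros difference_quotient_tendsto[OF wd] mh K) auto
    then show "(\<lambda>n. M / 2 * ((LINT x|lborel. ?d (h n) x) + (LINT x|lborel. ?d (- h n) x))) \<longlonglongrightarrow> 0" by simp
    show "\<forall>\<^sub>F n in sequentially. norm ((LINT x|lborel. \<phi> x *\<^sub>R ?Q n x) - (LINT x|lborel. \<phi> x *\<^sub>R ?R n x))
        \<le> M / 2 * ((LINT x|lborel. ?d (h n) x) + (LINT x|lborel. ?d (- h n) x))"
    proof (intro always_eventually allI)
      fix n
      have id: "integrable lborel (?d t)" for t
      proof -
        have "loc_int (\<lambda>x. (\<psi> (x + t *\<^sub>R w) - \<psi> x) /\<^sub>R t - f x)"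
          by (intro loc_int_diff loc_int_scaleR loc_int_translate li)
        from integrable_norm[OF loc_int_integrable[OF this K(1)]]
        show ?thesis by (simp only: norm_scaleR abs_indicator)
      qed
      \<comment> \<open>Multiplied by the step \<open>\<plusminus> h n\<close>, the error of each
        difference quotient is the distance from \<open>\<psi> (x \<plusminus> h n w)\<close> to the
        linearisation.\<close>
      have QR: "\<bar>?Q n x - ?R n x\<bar> \<le> (cmod ((\<psi> (x + h n *\<^sub>R w) - \<psi> x) /\<^sub>R h n - f x)
           + cmod ((\<psi> (x + (- h n) *\<^sub>R w) - \<psi> x) /\<^sub>R (- h n) - f x)) / 2" for x
      proof -
        have "\<bar>cmod (\<psi> (x + t *\<^sub>R w)) - cmod (\<psi> x + t *\<^sub>R f x)\<bar>
            \<le> \<bar>t\<bar> * cmod ((\<psi> (x + t *\<^sub>R w) - \<psi> x) /\<^sub>R t - f x)" if "t \<noteq> 0" for t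
        proof -
          have "\<bar>cmod (\<psi> (x + t *\<^sub>R w)) - cmod (\<psi> x + t *\<^sub>R f x)\<bar> \<le> cmod (\<psi> (x + t *\<^sub>R w) - (\<psi> x + t *\<^sub>R f x))"
            by (rule norm_triangle_ineq3)
          also have "\<psi> (x + t *\<^sub>R w) - (\<psi> x + t *\<^sub>R f x) = t *\<^sub>R ((\<psi> (x + t *\<^sub>R w) - \<psi> x) /\<^sub>R t - f x)"
            using that by (simp add: scaleR_diff_right)
          finally show ?thesis by simp
        qed
        from quotient_diff_le[OF _ this[of "h n"] this[of "- h n"]] h(2,3)[of n] show ?thesis
          by simp
      qed
      have le: "norm (\<phi> x *\<^sub>R (?Q n x - ?R n x)) \<le> M / 2 * (?d (h n) x + ?d (- h n) x)" for x
      proof (cases "x \<in> K")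
        case True
        with mult_mono[OF M(2) QR M(1) abs_ge_zero, of x x] show ?thesis by (simp add: abs_mult)
      qed (simp add: K(2))
      have eq: "(LINT x|lborel. \<phi> x *\<^sub>R ?Q n x) - (LINT x|lborel. \<phi> x *\<^sub>R ?R n x)
          = (LINT x|lborel. \<phi> x *\<^sub>R (?Q n x - ?R n x))"
        unfolding scaleR_diff_right
        by (rule Bochner_Integration.integral_diff[symmetric]; intro test_function_integrable lQ lR \<phi>)
      have "norm ((LINT x|lborel. \<phi> x *\<^sub>R ?Q n x) - (LINT x|lborel. \<phi> x *\<^sub>R ?R n x))
          \<le> (LINT x|lborel. norm (\<phi> x *\<^sub>R (?Q n x - ?R n x)))"
        unfolding eq by (rule integral_norm_bound)
      also have "\<dots> \<le> (LINT x|lborel. M / 2 * (?d (h n) x + ?d (- h n) x))"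
        by (intro integral_mono integrable_norm test_function_integrable loc_int_diff lQ lR \<phi> integrable_mult_right
              Bochner_Integration.integrable_add id le)
      also have "\<dots> = M / 2 * ((LINT x|lborel. ?d (h n) x) + (LINT x|lborel. ?d (- h n) x))"
        by (simp only: integral_mult_right_zero Bochner_Integration.integral_add[OF id id])
      finally show "norm ((LINT x|lborel. \<phi> x *\<^sub>R ?Q n x) - (LINT x|lborel. \<phi> x *\<^sub>R ?R n x))
        \<le> M / 2 * ((LINT x|lborel. ?d (h n) x) + (LINT x|lborel. ?d (- h n) x))" .
    qed
  qed
  have "(\<lambda>n. LINT x|lborel. \<phi> x *\<^sub>R ?Q n x) \<longlonglongrightarrow> (LINT x|lborel. \<phi> x *\<^sub>R ?g x)"
    using tendsto_add[OF lim3 lim2] by simp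
  from tendsto_minus[OF this] have "(\<lambda>n. LINT x|lborel. ?\<phi> n x *\<^sub>R cmod (\<psi> x)) \<longlonglongrightarrow> - (LINT x|lborel. \<phi> x *\<^sub>R ?g x)"
    by (simp only: parts)
  from LIMSEQ_unique[OF lim1 this]
  show "(LINT x|lborel. ?D x *\<^sub>R cmod (\<psi> x)) = - (LINT x|lborel. \<phi> x *\<^sub>R ?g x)" .
qed

section \<open>Lebesgue norms and weak gradients\<close>

lemma lebesgue_AE_iff: "(AE x in lebesgue. P x) \<longleftrightarrow> (AE x in lborel. P x)"
  by (rule AE_completion_iff)

lemma Lnorm_nonneg: "0 \<le> Lnorm q f"
  by (simp add: Lnorm_def Let_def)

lemma Lnorm_mono_AE:
  assumes "AE x in lborel. norm (f x) \<le> norm (g x)" "0 < q"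
  shows "Lnorm q f \<le> Lnorm q g"
proof -
  have "(\<integral>\<^sup>+ x. ennreal (norm (f x) powr q) \<partial>lebesgue) \<le> (\<integral>\<^sup>+ x. ennreal (norm (g x) powr q) \<partial>lebesgue)"
    using assms by (intro nn_integral_mono_AE) (auto simp: lebesgue_AE_iff intro!: powr_mono2 ennreal_leI elim: eventually_mono)
  then show ?thesis
    using assms(2) 
    by (auto simp: Lnorm_def Let_def top_unique intro!: powr_mono2 enn2real_mono enn2real_nonneg)
       (auto simp: less_top)
qed

lemma Lnorm_cong_AE:
  assumes "AE x in lborel. norm (f x) = norm (g x)" "0 < q"
  shows "Lnorm q f = Lnorm q g"
  using assms by (intro antisym Lnorm_mono_AE) (auto elim: eventually_mono)

lemma Lnorm_cmult:
  assumes "(\<integral>\<^sup>+ x. ennreal (norm (g x) powr q) \<partial>lebesgue)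
      = ennreal k * (\<integral>\<^sup>+ x. ennreal (norm (f x) powr q) \<partial>lebesgue)" and "0 < k"
  shows "Lnorm q g = ereal (k powr (1 / q)) * Lnorm q f"
  using assms
  by (auto simp: Lnorm_def Let_def ennreal_mult_eq_top_iff enn2real_mult powr_mult)

lemma Lnorm_scaleR:
  assumes "f \<in> borel_measurable lebesgue" "0 < c" "0 < q"
  shows "Lnorm q (\<lambda>x. c *\<^sub>R f x) = ereal c * Lnorm q f"
proof -
  have "(\<integral>\<^sup>+ x. ennreal (norm (c *\<^sub>R f x) powr q) \<partial>lebesgue)
      = ennreal (c powr q) * (\<integral>\<^sup>+ x. ennreal (norm (f x) powr q) \<partial>lebesgue)"
    using assms by (subst nn_integral_cmult[symmetric]) (auto simp: powr_mult ennreal_mult)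
  from Lnorm_cmult[OF this] assms show ?thesis by (simp add: powr_powr)
qed

section \<open>Change of variables under dilations\<close>

lemma nn_integral_lborel_dilate:
  fixes f :: "'a::euclidean_space \<Rightarrow> ennreal"
  assumes [measurable]: "f \<in> borel_measurable borel" and "0 < c"
  shows "(\<integral>\<^sup>+ x. f x \<partial>lborel) = ennreal (c ^ DIM('a)) * (\<integral>\<^sup>+ x. f (c *\<^sub>R x) \<partial>lborel)"
  using assms(2) by (subst lborel_affine[of c 0])
    (auto simp: nn_integral_density nn_integral_distr nn_integral_cmult)

lemma lborel_dilate:
  fixes f :: "'a::euclidean_space \<Rightarrow> 'b::{banach, second_countable_topology}"
  assumes [measurable]: "f \<in> borel_measurable borel" and c: "0 < c"
  shows integral_lborel_dilate: "(LINT x|lborel. f x) = c ^ DIM('a) *\<^sub>R (LINT x|lborel. f (c *\<^sub>R x))"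
    and integrable_lborel_dilate: "integrable lborel (\<lambda>x. f (c *\<^sub>R x)) \<longleftrightarrow> integrable lborel f"
proof -
  show "(LINT x|lborel. f x) = c ^ DIM('a) *\<^sub>R (LINT x|lborel. f (c *\<^sub>R x))"
    using c by (subst lborel_affine[of c 0])
      (auto simp: integral_density integral_distr integral_scaleR_right)
  have "integrable lborel f \<longleftrightarrow> integrable (density (distr lborel borel (\<lambda>x. 0 + c *\<^sub>R x)) (\<lambda>_::'a. ennreal (\<bar>c\<bar> ^ DIM('a)))) f"
    using c by (subst lborel_affine[of c 0]) auto
  also have "\<dots> \<longleftrightarrow> integrable lborel (\<lambda>x. f (c *\<^sub>R x))"
    using c integrable_scaleR_right[of "1 / c ^ DIM('a)" lborel "\<lambda>x. c ^ DIM('a) *\<^sub>R f (c *\<^sub>R x)"]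
    by (subst integrable_density) (auto simp: integrable_distr_eq)
  finally show "integrable lborel (\<lambda>x. f (c *\<^sub>R x)) \<longleftrightarrow> integrable lborel f" by simp
qed

lemma Lnorm_dilate:
  fixes f :: "'a::euclidean_space \<Rightarrow> 'b::euclidean_space"
  assumes [measurable]: "f \<in> borel_measurable borel" and "0 < c" "0 < q"
  shows "Lnorm q f = ereal (c powr (DIM('a) / q)) * Lnorm q (\<lambda>x. f (c *\<^sub>R x))"
proof -
  have "(\<integral>\<^sup>+ x. ennreal (norm (f x) powr q) \<partial>lebesgue)
      = ennreal (c ^ DIM('a)) * (\<integral>\<^sup>+ x. ennreal (norm (f (c *\<^sub>R x)) powr q) \<partial>lebesgue)"
    unfolding nn_integral_completion
    using assms by (subst nn_integral_lborel_dilate[of _ c]) auto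
  from Lnorm_cmult[OF this] assms show ?thesis by (simp add: powr_powr powr_realpow[symmetric])
qed

lemma Lnorm_eq_0_iff:
  assumes "f \<in> borel_measurable lebesgue" "0 < q"
  shows "Lnorm q f = 0 \<longleftrightarrow> ae_zero f"
proof -
  have "Lnorm q f = 0 \<longleftrightarrow> (\<integral>\<^sup>+ x. ennreal (norm (f x) powr q) \<partial>lebesgue) = 0"
    by (auto simp: Lnorm_def Let_def enn2real_eq_0_iff)
  also have "\<dots> \<longleftrightarrow> ae_zero f"
    using assms by (subst nn_integral_0_iff_AE) (auto simp: ae_zero_def)
  finally show ?thesis .
qed

lemma Lq_E:
  assumes "f \<in> Lq q" obtains r where "0 \<le> r" "Lnorm q f = ereal r"
  using assms Lnorm_nonneg[of q f] by (cases "Lnorm q f") (auto simp: Lq_def)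

text \<open>Each real coordinate agrees almost everywhere with a Borel function, and finitely many
  exceptional null sets are combined. This is the bridge from the Lebesgue-measurable functions of
  the statement to \<open>loc_int\<close>.\<close>

lemma borel_representative:
  fixes f :: "'a::euclidean_space \<Rightarrow> 'b::euclidean_space"
  assumes f: "f \<in> borel_measurable lebesgue"
  obtains g where "g \<in> borel_measurable borel" "AE x in lborel. f x = g x"
proof -
  have "\<exists>g\<in>borel_measurable lborel. AE x in lborel. f x \<bullet> b = g x" for b
    by (rule completion_ex_borel_measurable_real) (use f in auto)
  then obtain g where g: "\<And>b. g b \<in> borel_measurable lborel" "\<And>b. AE x in lborel. f x \<bullet> b = g b x"
    by metis
  show ?thesis
  proof (rule that)
    show "(\<lambda>x. \<Sum>b\<in>Basis. g b x *\<^sub>R b) \<in> borel_measurable borel"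
      using g(1) by (auto intro!: borel_measurable_sum borel_measurable_scaleR)
    have "AE x in lborel. \<forall>b\<in>Basis. f x \<bullet> b = g b x"
      using g(2) by (intro AE_finite_allI) auto
    then show "AE x in lborel. f x = (\<Sum>b\<in>Basis. g b x *\<^sub>R b)"
      by eventually_elim (metis (no_types, lifting) euclidean_representation sum.cong)
  qed
qed

lemma Lq_loc_1_loc_int:
  assumes f: "f \<in> Lq_loc 1" and g: "g \<in> borel_measurable borel" "AE x in lborel. f x = g x"
  shows "loc_int g"
  unfolding loc_int_def
proof (intro conjI allI impI g)
  fix K :: "'a set" assume K: "compact K"
  note [measurable] = g(1) borel_compact[OF K]
  have "Lnorm 1 (\<lambda>x. indicator K x *\<^sub>R f x) < \<infinity>"
    using f K by (auto simp: Lq_loc_def Lq_def)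
  moreover have "Lnorm 1 (\<lambda>x. indicator K x *\<^sub>R f x) = Lnorm 1 (\<lambda>x. indicator K x *\<^sub>R g x)"
    using g(2) by (intro Lnorm_cong_AE) (auto elim: eventually_mono)
  ultimately have "(\<integral>\<^sup>+ x. ennreal (norm (indicator K x *\<^sub>R g x)) \<partial>lborel) < \<infinity>"
    by (auto simp: Lnorm_def Let_def nn_integral_completion less_top split: if_splits)
  then show "integrable lborel (\<lambda>x. indicator K x *\<^sub>R g x)"
    by (intro integrableI_bounded) auto
qed

lemma loc_int_Lq_loc_1:
  assumes f: "loc_int f" shows "f \<in> Lq_loc 1"
  unfolding Lq_loc_def
proof (intro CollectI conjI allI impI)
  note [measurable] = loc_int_measurable[OF f]
  show m: "f \<in> borel_measurable lebesgue" by (rule measurable_completion) simp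
  fix K :: "'a set" assume K: "compact K"
  note [measurable] = borel_compact[OF K]
  have "(\<integral>\<^sup>+ x. ennreal (norm (indicator K x *\<^sub>R f x)) \<partial>lborel) < \<infinity>"
    using loc_int_integrable[OF f K] by (auto simp: integrable_iff_bounded)
  moreover have "(\<lambda>x. indicator K x *\<^sub>R f x) \<in> borel_measurable lebesgue"
    by (rule measurable_completion) measurable
  ultimately show "(\<lambda>x. indicator K x *\<^sub>R f x) \<in> Lq 1"
    by (auto simp: Lq_def Lnorm_def Let_def nn_integral_completion)
qed

lemma borel_measurable_nth:
  "F \<in> borel_measurable M \<Longrightarrow> (\<lambda>x. F x $ i) \<in> borel_measurable M"
  by (rule measurable_compose[where f=F]) (auto intro!: borel_measurable_continuous_onI continuous_intros)

lemma loc_int_nth: "loc_int F \<Longrightarrow> loc_int (\<lambda>x. F x $ i)"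
  by (rule loc_int_bound)
     (auto intro: Finite_Cartesian_Product.norm_nth_le loc_int_measurable borel_measurable_nth)

lemma loc_int_vec:
  fixes F :: "'a::euclidean_space \<Rightarrow> complex^'n"
  assumes "\<And>i. loc_int (\<lambda>x. F x $ i)" shows "loc_int F"
  unfolding loc_int_def
proof (intro conjI allI impI)
  note [measurable] = loc_int_measurable[OF assms]
  have eq: "F = (\<lambda>x. \<Sum>i\<in>UNIV. axis i (F x $ i))"
    by (auto simp: fun_eq_iff vec_eq_iff axis_def if_distrib cong: if_cong)
  have "(\<lambda>x. axis i (F x $ i)) \<in> borel_measurable borel" for i
    by (rule measurable_compose[OF loc_int_measurable[OF assms[of i]]])
       (auto intro!: borel_measurable_continuous_onI linear_continuous_on linear_linear[THEN iffD2]
             simp: axis_def vec_eq_iff linear_iff)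
  then show m: "F \<in> borel_measurable borel" by (subst eq) (intro borel_measurable_sum)
  fix K :: "'a set" assume K: "compact K"
  note [measurable] = borel_compact[OF K] m
  show "integrable lborel (\<lambda>x. indicator K x *\<^sub>R F x)"
  proof (rule Bochner_Integration.integrable_bound)
    show "integrable lborel (\<lambda>x. \<Sum>i\<in>UNIV. norm (indicator K x *\<^sub>R (F x $ i)))"
      by (intro Bochner_Integration.integrable_sum integrable_norm loc_int_integrable assms K)
    have "norm (F x) \<le> (\<Sum>i\<in>UNIV. norm (F x $ i))" for x
      by (auto simp: norm_vec_def intro: L2_set_le_sum)
    then show "AE x in lborel. norm (indicator K x *\<^sub>R F x) \<le> norm (\<Sum>i\<in>UNIV. norm (indicator K x *\<^sub>R (F x $ i)))"
      by (intro AE_I2) (auto simp: indicator_def sum_nonneg)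
  qed measurable
qed

section \<open>Weak gradients versus directional weak derivatives\<close>

lemma has_weak_grad_weak_deriv:
  fixes \<psi> :: "real^'n \<Rightarrow> complex"
  assumes wg: "has_weak_grad \<psi> F"
    and \<psi>': "\<psi>' \<in> borel_measurable borel" "AE x in lborel. \<psi> x = \<psi>' x"
    and F': "F' \<in> borel_measurable borel" "AE x in lborel. F x = F' x"
  shows "weak_deriv (axis i 1) \<psi>' (\<lambda>x. F' x $ i)"
  unfolding weak_deriv_def
proof (intro conjI ballI)
  have L: "\<psi> \<in> Lq_loc 1" "F \<in> Lq_loc 1" using wg by (auto simp: has_weak_grad_def)
  show li: "loc_int \<psi>'" using Lq_loc_1_loc_int[OF L(1) \<psi>'] .
  show lF: "loc_int (\<lambda>x. F' x $ i)" by (intro loc_int_nth Lq_loc_1_loc_int[OF L(2) F'])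
  note [measurable] = \<psi>'(1) loc_int_measurable[OF lF]
  have [measurable]: "\<psi> \<in> borel_measurable lebesgue" "F \<in> borel_measurable lebesgue"
    using L by (auto simp: Lq_loc_def)
  have Fi [measurable]: "(\<lambda>x. F x $ i) \<in> borel_measurable lebesgue"
    by (rule borel_measurable_nth) measurable
  fix \<phi> :: "real^'n \<Rightarrow> real" assume \<phi>: "\<phi> \<in> test_functions"
  let ?D = "\<lambda>x. frechet_derivative \<phi> (at x) (axis i 1)"
  have m: "\<phi> \<in> borel_measurable borel" "?D \<in> borel_measurable borel"
    using \<phi> by (auto intro!: borel_measurable_continuous_onI test_function_continuous test_function_deriv_continuous)
  note [measurable] = m
  have [measurable]: "\<phi> \<in> borel_measurable lebesgue" "?D \<in> borel_measurable lebesgue"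
    "\<psi>' \<in> borel_measurable lebesgue" "(\<lambda>x. F' x $ i) \<in> borel_measurable lebesgue"
    using m \<psi>' loc_int_measurable[OF lF] by (auto intro: measurable_completion)
  have "(LINT x|lborel. ?D x *\<^sub>R \<psi>' x) = (LINT x|lebesgue. ?D x *\<^sub>R \<psi>' x)"
    by (rule integral_completion[symmetric]) measurable
  also have "\<dots> = (LINT x|lebesgue. ?D x *\<^sub>R \<psi> x)"
    using \<psi>'(2) by (intro integral_cong_AE) (auto simp: lebesgue_AE_iff elim: eventually_mono)
  also have "\<dots> = - (LINT x|lebesgue. \<phi> x *\<^sub>R (F x $ i))"
    using wg \<phi> by (simp add: has_weak_grad_def)
  also have "(LINT x|lebesgue. \<phi> x *\<^sub>R (F x $ i)) = (LINT x|lebesgue. \<phi> x *\<^sub>R (F' x $ i))"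
    using F'(2) by (intro integral_cong_AE) (auto simp: lebesgue_AE_iff elim: eventually_mono)
  also have "\<dots> = (LINT x|lborel. \<phi> x *\<^sub>R (F' x $ i))"
    by (rule integral_completion) measurable
  finally show "(LINT x|lborel. ?D x *\<^sub>R \<psi>' x) = - (LINT x|lborel. \<phi> x *\<^sub>R (F' x $ i))" .
qed

lemma weak_deriv_has_weak_grad:
  fixes \<psi> :: "real^'n \<Rightarrow> complex"
  assumes wd: "\<And>i. weak_deriv (axis i 1) \<psi> (\<lambda>x. F x $ i)"
  shows "has_weak_grad \<psi> F"
  unfolding has_weak_grad_def
proof (intro conjI ballI allI)
  have li: "loc_int \<psi>" "\<And>i. loc_int (\<lambda>x. F x $ i)" using wd by (auto simp: weak_deriv_def)
  show "\<psi> \<in> Lq_loc 1" "F \<in> Lq_loc 1" by (intro loc_int_Lq_loc_1 loc_int_vec li)+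
  fix \<phi> :: "real^'n \<Rightarrow> real" and i assume \<phi>: "\<phi> \<in> test_functions"
  note [measurable] = li[THEN loc_int_measurable]
  have [measurable]: "\<phi> \<in> borel_measurable borel"
    "(\<lambda>x. frechet_derivative \<phi> (at x) (axis i 1)) \<in> borel_measurable borel"
    using \<phi> by (auto intro!: borel_measurable_continuous_onI test_function_continuous test_function_deriv_continuous)
  show "(LINT x|lebesgue. frechet_derivative \<phi> (at x) (axis i 1) *\<^sub>R \<psi> x) = - (LINT x|lebesgue. \<phi> x *\<^sub>R (F x $ i))"
    using wd[of i] \<phi> by (simp add: integral_completion weak_deriv_def)
qed

text \<open>The difference of two candidates integrates to 0 against every test function, so the
  fundamental lemma applies to each component. This lets norms of the chosen \<open>mag_grad\<close>
  be computed from any witness.\<close>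

lemma has_weak_grad_unique:
  fixes \<psi> :: "real^'n \<Rightarrow> complex"
  assumes 1: "has_weak_grad \<psi> F1" and 2: "has_weak_grad \<psi> F2"
  shows "AE x in lborel. F1 x = F2 x"
proof -
  have m: "\<psi> \<in> borel_measurable lebesgue" "F1 \<in> borel_measurable lebesgue" "F2 \<in> borel_measurable lebesgue"
    using assms by (auto simp: has_weak_grad_def Lq_loc_def)
  obtain \<psi>' where \<psi>': "\<psi>' \<in> borel_measurable borel" "AE x in lborel. \<psi> x = \<psi>' x"
    using borel_representative[OF m(1)] .
  obtain G1 where G1: "G1 \<in> borel_measurable borel" "AE x in lborel. F1 x = G1 x"
    using borel_representative[OF m(2)] .
  obtain G2 where G2: "G2 \<in> borel_measurable borel" "AE x in lborel. F2 x = G2 x"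
    using borel_representative[OF m(3)] .
  have "AE x in lborel. G1 x $ i - G2 x $ i = 0" for i
  proof (rule fundamental_lemma_calculus_of_variations)
    have w: "weak_deriv (axis i 1) \<psi>' (\<lambda>x. G1 x $ i)" "weak_deriv (axis i 1) \<psi>' (\<lambda>x. G2 x $ i)"
      using has_weak_grad_weak_deriv[OF 1 \<psi>' G1] has_weak_grad_weak_deriv[OF 2 \<psi>' G2] by auto
    then have li: "loc_int (\<lambda>x. G1 x $ i)" "loc_int (\<lambda>x. G2 x $ i)" by (auto simp: weak_deriv_def)
    then show "loc_int (\<lambda>x. G1 x $ i - G2 x $ i)" by (rule loc_int_diff)
    fix \<phi> :: "real^'n \<Rightarrow> real" assume \<phi>: "\<phi> \<in> test_functions"
    have "(LINT x|lborel. \<phi> x *\<^sub>R (G1 x $ i)) = (LINT x|lborel. \<phi> x *\<^sub>R (G2 x $ i))"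
      using w \<phi> by (simp add: weak_deriv_def)
    then show "(LINT x|lborel. \<phi> x *\<^sub>R (G1 x $ i - G2 x $ i)) = 0"
      using li[THEN test_function_integrable[OF _ \<phi>]] by (simp add: scaleR_diff_right)
  qed
  then have "AE x in lborel. \<forall>i. G1 x $ i - G2 x $ i = 0" by (simp add: AE_all_countable)
  with G1(2) G2(2) show ?thesis by eventually_elim (simp add: vec_eq_iff)
qed

lemma Lnorm_mag_grad:
  fixes \<psi> :: "real^'n \<Rightarrow> complex"
  assumes G: "has_mag_grad A \<psi> G" and q: "0 < q"
  shows "Lnorm q (mag_grad A \<psi>) = Lnorm q G"
proof -
  have "has_mag_grad A \<psi> (mag_grad A \<psi>)"
    unfolding mag_grad_def using G by (rule someI[of "has_mag_grad A \<psi>"])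
  from has_weak_grad_unique[OF this[unfolded has_mag_grad_def] G[unfolded has_mag_grad_def]]
  show ?thesis by (intro Lnorm_cong_AE q) (auto elim: eventually_mono)
qed

lemma has_mag_grad_zero: "has_mag_grad (\<lambda>_. 0) \<psi> G \<longleftrightarrow> has_weak_grad \<psi> G"
proof -
  have "(\<chi> i. \<i> * complex_of_real ((0::real^'a) $ i) * z) = 0" for z by (simp add: vec_eq_iff)
  then show ?thesis by (simp add: has_mag_grad_def)
qed

section \<open>The diamagnetic inequality and the interpolation estimate\<close>

lemma loc_int_dilate:
  fixes f :: "'a::euclidean_space \<Rightarrow> 'b::euclidean_space"
  assumes f: "loc_int f" and c: "0 < c" shows "loc_int (\<lambda>x. f (c *\<^sub>R x))"
  unfolding loc_int_def
proof (intro conjI allI impI)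
  note [measurable] = loc_int_measurable[OF f]
  show "(\<lambda>x. f (c *\<^sub>R x)) \<in> borel_measurable borel" by measurable
  fix K :: "'a set" assume K: "compact K"
  let ?K = "(\<lambda>x. c *\<^sub>R x) ` K"
  have K': "compact ?K" using K by (rule compact_scaling)
  then have [measurable]: "?K \<in> sets borel" by (rule borel_compact)
  have "integrable lborel (\<lambda>x. indicator ?K (c *\<^sub>R x) *\<^sub>R f (c *\<^sub>R x))"
    using loc_int_integrable[OF f K'] c
    by (subst integrable_lborel_dilate[of "\<lambda>x. indicator ?K x *\<^sub>R f x"]) auto
  also have "(\<lambda>x. indicator ?K (c *\<^sub>R x) *\<^sub>R f (c *\<^sub>R x)) = (\<lambda>x. indicator K x *\<^sub>R f (c *\<^sub>R x))"
    using c by (auto simp: indicator_def fun_eq_iff)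
  finally show "integrable lborel (\<lambda>x. indicator K x *\<^sub>R f (c *\<^sub>R x))" .
qed

text \<open>The dilation is moved onto the test function, whose derivative picks up
  \<open>1 / c\<close>. The Jacobian \<open>c ^ DIM('a)\<close> appears on both sides and
  cancels.\<close>

lemma weak_deriv_dilate:
  fixes \<psi> :: "'a::euclidean_space \<Rightarrow> 'b::euclidean_space"
  assumes wd: "weak_deriv w \<psi> f" and c: "0 < c"
  shows "weak_deriv w (\<lambda>x. \<psi> (c *\<^sub>R x)) (\<lambda>x. c *\<^sub>R f (c *\<^sub>R x))"
  unfolding weak_deriv_def
proof (intro conjI ballI)
  have li: "loc_int \<psi>" "loc_int f" using wd by (auto simp: weak_deriv_def)
  note [measurable] = li[THEN loc_int_measurable]
  show "loc_int (\<lambda>x. \<psi> (c *\<^sub>R x))" "loc_int (\<lambda>x. c *\<^sub>R f (c *\<^sub>R x))"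
    by (intro loc_int_scaleR loc_int_dilate li c)+
  fix \<phi> :: "'a \<Rightarrow> real" assume \<phi>: "\<phi> \<in> test_functions"
  let ?D = "\<lambda>x. frechet_derivative \<phi> (at x) w"
  let ?\<phi> = "\<lambda>x. \<phi> ((1 / c) *\<^sub>R x)"
  have \<phi>': "?\<phi> \<in> test_functions"
    using test_functions_affine[OF \<phi>, of "1 / c" 0] c by simp
  have D': "frechet_derivative ?\<phi> (at x) w = (1 / c) * ?D ((1 / c) *\<^sub>R x)" for x
    using frechet_derivative_affine[OF test_function_differentiable[OF \<phi>], of "1 / c" 0 x]
    by (intro frechet_derivative_apply) simp
  have [measurable]: "\<phi> \<in> borel_measurable borel" "?D \<in> borel_measurable borel"
    using \<phi> by (auto intro!: borel_measurable_continuous_onI test_function_continuous test_function_deriv_continuous)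
  have "c ^ DIM('a) *\<^sub>R (LINT x|lborel. ?D x *\<^sub>R \<psi> (c *\<^sub>R x)) = (LINT x|lborel. ?D ((1 / c) *\<^sub>R x) *\<^sub>R \<psi> x)"
    using c by (subst integral_lborel_dilate[of _ c]) auto
  also have "\<dots> = (LINT x|lborel. c *\<^sub>R (frechet_derivative ?\<phi> (at x) w *\<^sub>R \<psi> x))"
    using c by (intro Bochner_Integration.integral_cong) (auto simp: D')
  also have "\<dots> = c *\<^sub>R (LINT x|lborel. frechet_derivative ?\<phi> (at x) w *\<^sub>R \<psi> x)"
    by (rule integral_scaleR_right)
  also have "\<dots> = - (c *\<^sub>R (LINT x|lborel. ?\<phi> x *\<^sub>R f x))"
    using wd \<phi>' by (simp add: weak_deriv_def)
  also have "(LINT x|lborel. ?\<phi> x *\<^sub>R f x) = c ^ DIM('a) *\<^sub>R (LINT x|lborel. \<phi> x *\<^sub>R f (c *\<^sub>R x))"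
    using c by (subst integral_lborel_dilate[of _ c]) auto
  also have "- (c *\<^sub>R (c ^ DIM('a) *\<^sub>R (LINT x|lborel. \<phi> x *\<^sub>R f (c *\<^sub>R x))))
      = c ^ DIM('a) *\<^sub>R - (LINT x|lborel. c *\<^sub>R (\<phi> x *\<^sub>R f (c *\<^sub>R x)))"
    by (simp only: integral_scaleR_right scaleR_minus_right scaleR_left_commute)
  finally have "c ^ DIM('a) *\<^sub>R (LINT x|lborel. ?D x *\<^sub>R \<psi> (c *\<^sub>R x))
      = c ^ DIM('a) *\<^sub>R - (LINT x|lborel. c *\<^sub>R (\<phi> x *\<^sub>R f (c *\<^sub>R x)))" .
  then have eq: "(LINT x|lborel. ?D x *\<^sub>R \<psi> (c *\<^sub>R x)) = - (LINT x|lborel. c *\<^sub>R (\<phi> x *\<^sub>R f (c *\<^sub>R x)))"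
    by (rule scaleR_left_imp_eq[rotated]) (use c in simp)
  have "\<phi> x *\<^sub>R (c *\<^sub>R f (c *\<^sub>R x)) = c *\<^sub>R (\<phi> x *\<^sub>R f (c *\<^sub>R x))" for x
    by (rule scaleR_left_commute)
  then show "(LINT x|lborel. ?D x *\<^sub>R \<psi> (c *\<^sub>R x)) = - (LINT x|lborel. \<phi> x *\<^sub>R (c *\<^sub>R f (c *\<^sub>R x)))"
    by (simp only: eq)
qed

text \<open>The infimum in \<open>C_const\<close> ranges over complex-valued functions, so the real
  modulus has to be embedded.\<close>

lemma weak_deriv_of_real:
  fixes \<psi> :: "'a::euclidean_space \<Rightarrow> real"
  assumes wd: "weak_deriv w \<psi> f"
  shows "weak_deriv w (\<lambda>x. complex_of_real (\<psi> x)) (\<lambda>x. complex_of_real (f x))"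
proof -
  have li: "loc_int \<psi>" "loc_int f" using wd by (auto simp: weak_deriv_def)
  have "loc_int (\<lambda>x. complex_of_real (g x))" if "loc_int g" for g :: "'a \<Rightarrow> real"
    using loc_int_measurable[OF that] by (intro loc_int_bound[OF that]) auto
  moreover have "(LINT x|lborel. a x *\<^sub>R complex_of_real (g x)) = complex_of_real (LINT x|lborel. a x *\<^sub>R g x)"
    for a g :: "'a \<Rightarrow> real"
    by (simp add: scaleR_conv_of_real flip: of_real_mult)
  ultimately show ?thesis using wd li by (simp add: weak_deriv_def)
qed

text \<open>The magnetic term \<open>\<i> A\<^sub>i \<psi>\<close> is orthogonal to \<open>\<psi>\<close>, so it does not contribute to the derivative of \<open>\<bar>\<psi>\<bar>\<close>.\<close>

lemma cmod_deriv_magnetic: "cmod_deriv z (g - \<i> * complex_of_real a * z) = cmod_deriv z g"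
  by (simp add: cmod_deriv_def algebra_simps)

text \<open>Each component of the gradient of the modulus is \<open>cmod_deriv\<close> applied to a
  component of \<open>G\<close>, hence bounded by it. The result is stated for Borel
  \<open>u\<close> and \<open>U\<close> with directional weak derivatives because it is dilated
  before membership in \<open>H1\<close> is claimed.\<close>

lemma diamagnetic:
  fixes A :: "real^'n \<Rightarrow> real^'n"
  assumes \<psi>: "\<psi> \<in> H1_mag A"
  obtains u U where "u \<in> borel_measurable borel" "U \<in> borel_measurable borel"
    "AE x in lborel. cmod (u x) = cmod (\<psi> x)"
    "\<And>i. weak_deriv (axis i 1) u (\<lambda>x. U x $ i)" "Lnorm 2 U \<le> Lnorm 2 (mag_grad A \<psi>)"
proof -
  obtain G where G: "has_mag_grad A \<psi> G" using \<psi> by (auto simp: H1_mag_def)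
  define F where "F = (\<lambda>x. G x - (\<chi> i. \<i> * complex_of_real (A x $ i) * \<psi> x))"
  have wg: "has_weak_grad \<psi> F" using G by (simp add: has_mag_grad_def F_def)
  have m: "\<psi> \<in> borel_measurable lebesgue" "F \<in> borel_measurable lebesgue"
    using wg by (auto simp: has_weak_grad_def Lq_loc_def)
  obtain \<psi>' where \<psi>': "\<psi>' \<in> borel_measurable borel" "AE x in lborel. \<psi> x = \<psi>' x"
    using borel_representative[OF m(1)] .
  obtain F' where F': "F' \<in> borel_measurable borel" "AE x in lborel. F x = F' x"
    using borel_representative[OF m(2)] .
  define u where "u = (\<lambda>x. complex_of_real (cmod (\<psi>' x)))"
  define U :: "real^'n \<Rightarrow> complex^'n" where "U = (\<lambda>x. \<chi> i. complex_of_real (cmod_deriv (\<psi>' x) (F' x $ i)))"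
  have w: "weak_deriv (axis i 1) u (\<lambda>x. U x $ i)" for i
    using weak_deriv_of_real[OF weak_deriv_cmod[OF has_weak_grad_weak_deriv[OF wg \<psi>' F', of i]]]
    by (simp add: u_def U_def)
  then have "loc_int U" by (intro loc_int_vec) (auto simp: weak_deriv_def)
  then have U: "U \<in> borel_measurable borel" by (rule loc_int_measurable)
  have "AE x in lborel. norm (U x) \<le> norm (G x)"
    using \<psi>'(2) F'(2)
  proof eventually_elim
    case (elim x)
    have "cmod (U x $ i) \<le> cmod (G x $ i)" for i
    proof -
      have "U x $ i = complex_of_real (cmod_deriv (\<psi> x) (F x $ i))" using elim by (simp add: U_def)
      also have "cmod_deriv (\<psi> x) (F x $ i) = cmod_deriv (\<psi> x) (G x $ i)"
        by (simp add: F_def cmod_deriv_magnetic)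
      finally show ?thesis by (simp add: abs_cmod_deriv_le)
    qed
    then show ?case by (auto simp: norm_vec_def intro: L2_set_mono)
  qed
  then have "Lnorm 2 U \<le> Lnorm 2 G" by (rule Lnorm_mono_AE) simp
  also have "Lnorm 2 G = Lnorm 2 (mag_grad A \<psi>)" using Lnorm_mag_grad[OF G, of 2] by simp
  finally have le: "Lnorm 2 U \<le> Lnorm 2 (mag_grad A \<psi>)" .
  show ?thesis
  proof (rule that[OF _ U _ w le])
    show "u \<in> borel_measurable borel" using w by (auto simp: weak_deriv_def loc_int_def)
    show "AE x in lborel. cmod (u x) = cmod (\<psi> x)"
      using \<psi>'(2) by eventually_elim (simp add: u_def)
  qed
qed

section \<open>The Gagliardo-Nirenberg inequality with a magnetic field\<close>

lemma H1_mag_E: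
  assumes "\<psi> \<in> H1_mag A"
  obtains G N where "Lnorm 2 (mag_grad A \<psi>) = ereal G" "Lnorm 2 \<psi> = ereal N" "0 \<le> G" "0 \<le> N"
proof -
  obtain G where G: "has_mag_grad A \<psi> G" "G \<in> Lq 2" using assms by (auto simp: H1_mag_def)
  have \<psi>: "\<psi> \<in> Lq 2" using assms by (auto simp: H1_mag_def)
  show ?thesis
    using Lq_E[OF G(2)] Lq_E[OF \<psi>] that Lnorm_mag_grad[OF G(1), of 2] by (metis zero_less_numeral)
qed

lemma H1_weak_grad_I:
  fixes u :: "real^'n \<Rightarrow> complex"
  assumes "\<And>i. weak_deriv (axis i 1) u (\<lambda>x. U x $ i)"
    and "u \<in> borel_measurable borel" "U \<in> borel_measurable borel" "Lnorm 2 u < \<infinity>" "Lnorm 2 U < \<infinity>"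
  shows "u \<in> H1" "Lnorm 2 (weak_grad u) = Lnorm 2 U"
proof -
  have g: "has_mag_grad (\<lambda>_. 0) u U"
    using weak_deriv_has_weak_grad[OF assms(1)] by (simp add: has_mag_grad_zero)
  then show "Lnorm 2 (weak_grad u) = Lnorm 2 U" by (rule Lnorm_mag_grad) simp
  show "u \<in> H1" using g assms(4,5) measurable_completion[of u lborel borel] measurable_completion[of U lborel borel] assms(2,3)
    by (auto simp: H1_mag_def Lq_def intro!: exI[of _ U])
qed

lemma ereal_power2_nonneg: "0 \<le> (x::ereal)\<^sup>2"
  by (cases x) (auto simp: power2_eq_square)

text \<open>The quotient of \<open>u\<close> bounds the infimum from above by a finite number, so
  \<open>real_of_ereal\<close> loses nothing. If the p-norm is infinite, the extended-real quotient
  is 0 and forces the infimum to be 0.\<close>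

lemma C_const_le:
  fixes u :: "real^'n \<Rightarrow> complex"
  assumes u: "u \<in> H1" "\<not> ae_zero u" and p: "0 < p"
    and ab: "Lnorm 2 (weak_grad u) = ereal a" "Lnorm 2 u = ereal b"
  shows "Lnorm p u = \<infinity> \<Longrightarrow> C_const TYPE('n) p = 0"
    and "Lnorm p u = ereal P \<Longrightarrow> C_const TYPE('n) p * P\<^sup>2 \<le> a\<^sup>2 + b\<^sup>2"
proof -
  define I where "I = (INF u \<in> {u \<in> (H1 :: (real^'n \<Rightarrow> complex) set). \<not> ae_zero u}.
        ((Lnorm 2 (weak_grad u))\<^sup>2 + (Lnorm 2 u)\<^sup>2) / (Lnorm p u)\<^sup>2)"
  have I0: "0 \<le> I"
    unfolding I_def by (intro INF_greatest zero_le_divide_ereal) (auto simp: ereal_power2_nonneg)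
  have "I \<le> ((Lnorm 2 (weak_grad u))\<^sup>2 + (Lnorm 2 u)\<^sup>2) / (Lnorm p u)\<^sup>2"
    unfolding I_def using u by (intro INF_lower) auto
  then have Iu: "I \<le> ereal (a\<^sup>2 + b\<^sup>2) / (Lnorm p u)\<^sup>2" by (simp add: ab)
  have C: "C_const TYPE('n) p = real_of_ereal I" by (simp add: C_const_def I_def)
  show "C_const TYPE('n) p = 0" if "Lnorm p u = \<infinity>"
  proof -
    have "(\<infinity>::ereal)\<^sup>2 = \<infinity>" by (simp add: power2_eq_square)
    with Iu that have "I \<le> 0" by simp
    with I0 show ?thesis by (simp add: C)
  qed
  show "C_const TYPE('n) p * P\<^sup>2 \<le> a\<^sup>2 + b\<^sup>2" if P: "Lnorm p u = ereal P"
  proof -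
    have "u \<in> borel_measurable lebesgue" using u(1) by (auto simp: H1_mag_def Lq_def)
    then have "P \<noteq> 0" using Lnorm_eq_0_iff[of u p] p u(2) P by auto
    then have "P\<^sup>2 > 0" by simp
    then have "I \<le> ereal ((a\<^sup>2 + b\<^sup>2) / P\<^sup>2)" using Iu P \<open>P \<noteq> 0\<close> by simp
    with I0 have "C_const TYPE('n) p \<le> (a\<^sup>2 + b\<^sup>2) / P\<^sup>2"
      unfolding C by (cases I) auto
    then show ?thesis using \<open>P\<^sup>2 > 0\<close> by (simp add: field_simps)
  qed
qed

text \<open>Exponent bookkeeping for the dilation by \<open>c\<close>: since
  \<open>d (p - 2) / (2 p) = d / 2 - d / p\<close>, both sides of the second identity equal
  \<open>\<kappa> powr (- d / 2)\<close>.\<close>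

lemma dilation_exponent:
  fixes \<kappa> d p :: real
  assumes "0 < \<kappa>" "0 < p" defines "c \<equiv> \<kappa> powr (- 1 / 2)"
  shows "\<kappa> * c\<^sup>2 = 1" "\<kappa> powr (1 - d * ((p - 2) / (2 * p))) * (c powr (d / p))\<^sup>2 * c\<^sup>2 = (c powr (d / 2))\<^sup>2"
proof -
  have sq: "(x powr y)\<^sup>2 = x powr (2 * y)" for x y :: real
    by (simp add: power2_eq_square powr_add[symmetric])
  show "\<kappa> * c\<^sup>2 = 1" using assms(1) unfolding c_def sq by (simp add: powr_minus_divide)
  show "\<kappa> powr (1 - d * ((p - 2) / (2 * p))) * (c powr (d / p))\<^sup>2 * c\<^sup>2 = (c powr (d / 2))\<^sup>2"
    unfolding c_def powr_powr sq powr_add[symmetric]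
    using assms(2) by (simp add: field_simps)
qed

lemma magnetic_gagliardo_nirenberg:
  fixes A :: "real^'n \<Rightarrow> real^'n"
  assumes \<psi>: "\<psi> \<in> H1_mag A" "\<not> ae_zero \<psi>" and p: "0 < p" and \<kappa>: "0 < \<kappa>"
    and GN: "Lnorm 2 (mag_grad A \<psi>) = ereal G" "Lnorm 2 \<psi> = ereal N"
  shows "Lnorm p \<psi> = \<infinity> \<Longrightarrow> C_const TYPE('n) p = 0"
    and "Lnorm p \<psi> = ereal P \<Longrightarrow>
      C_const TYPE('n) p * \<kappa> powr (1 - real CARD('n) * ((p - 2) / (2 * p))) * P\<^sup>2 \<le> G\<^sup>2 + \<kappa> * N\<^sup>2"
proof -
  let ?d = "real CARD('n)" and ?C = "C_const TYPE('n) p"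
  obtain u and U where u: "u \<in> borel_measurable borel" and U: "U \<in> borel_measurable borel"
    and u\<psi>: "AE x in lborel. cmod (u x) = cmod (\<psi> x)"
    and wd: "\<And>i. weak_deriv (axis i 1) u (\<lambda>x. U x $ i)"
    and le: "Lnorm 2 U \<le> Lnorm 2 (mag_grad A \<psi>)"
    using diamagnetic[OF \<psi>(1)] by blast
  \<comment> \<open>With \<open>\<kappa> c^2 = 1\<close>, the dilated pair \<open>v\<close>,
    \<open>V\<close> satisfies \<open>|U|^2 + \<kappa> |u|^2 = \<kappa> k^2 (|V|^2 + |v|^2)\<close>
    in \<open>L^2\<close> norms, where \<open>k = c powr (d / 2)\<close>; so the weight \<kappa> is
    scaled away.\<close>
  define c where "c = \<kappa> powr (- 1 / 2)"
  have c: "c > 0" using \<kappa> by (simp add: c_def)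
  define v where "v = (\<lambda>x. u (c *\<^sub>R x))"
  define V where "V = (\<lambda>x. c *\<^sub>R U (c *\<^sub>R x))"
  have v [measurable]: "v \<in> borel_measurable borel" and V [measurable]: "V \<in> borel_measurable borel"
    and Uc [measurable]: "(\<lambda>x. U (c *\<^sub>R x)) \<in> borel_measurable borel"
    using u U unfolding v_def V_def by measurable
  have wd': "weak_deriv (axis i 1) v (\<lambda>x. V x $ i)" for i
    using weak_deriv_dilate[OF wd c, of i] by (simp add: v_def V_def)
  have norm_v: "Lnorm q \<psi> = ereal (c powr (?d / q)) * Lnorm q v" if "0 < q" for q
    using Lnorm_cong_AE[OF u\<psi> that] Lnorm_dilate[OF u c that] by (simp add: v_def)
  have norm_U: "Lnorm 2 U = ereal (c powr (?d / 2)) * Lnorm 2 (\<lambda>x. U (c *\<^sub>R x))"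
    using Lnorm_dilate[OF U c, of 2] by simp
  have norm_V: "Lnorm 2 V = ereal c * Lnorm 2 (\<lambda>x. U (c *\<^sub>R x))"
    unfolding V_def by (intro Lnorm_scaleR measurable_completion) (use c Uc in auto)
  define k where "k = c powr (?d / 2)"
  have k: "k > 0" using c by (simp add: k_def)
  obtain b where b: "Lnorm 2 v = ereal b" "N = k * b" "0 \<le> b"
    using norm_v[of 2] GN(2) Lnorm_nonneg[of 2 v] k by (cases "Lnorm 2 v") (auto simp: k_def)
  obtain a where a: "Lnorm 2 (\<lambda>x. U (c *\<^sub>R x)) = ereal a" "k * a \<le> G" "0 \<le> a"
    using norm_U le GN(1) Lnorm_nonneg[of 2 "\<lambda>x. U (c *\<^sub>R x)"] k
    by (cases "Lnorm 2 (\<lambda>x. U (c *\<^sub>R x))") (auto simp: k_def)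
  have V2: "Lnorm 2 V = ereal (c * a)" using norm_V a(1) by simp
  have H1: "v \<in> H1" and wg: "Lnorm 2 (weak_grad v) = ereal (c * a)"
    using H1_weak_grad_I[OF wd' v V] b(1) V2 by auto
  have "v \<in> borel_measurable lebesgue" "\<psi> \<in> borel_measurable lebesgue"
    using H1 \<psi>(1) by (auto simp: H1_mag_def Lq_def)
  then have nz: "\<not> ae_zero v"
    using \<psi>(2) Lnorm_eq_0_iff[of v 2] Lnorm_eq_0_iff[of \<psi> 2] norm_v[of 2] by auto
  note C = C_const_le[OF H1 nz p wg b(1)]
  show "?C = 0" if "Lnorm p \<psi> = \<infinity>"
    using that norm_v[OF p] c by (intro C(1)) (cases "Lnorm p v", auto)
  show "?C * \<kappa> powr (1 - ?d * ((p - 2) / (2 * p))) * P\<^sup>2 \<le> G\<^sup>2 + \<kappa> * N\<^sup>2" if P: "Lnorm p \<psi> = ereal P"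
  proof -
    define l where "l = c powr (?d / p)"
    obtain P' where P': "Lnorm p v = ereal P'" "P = l * P'"
      using norm_v[OF p] P c by (cases "Lnorm p v") (auto simp: l_def)
    have e: "\<kappa> * c\<^sup>2 = 1" "\<kappa> powr (1 - ?d * ((p - 2) / (2 * p))) * l\<^sup>2 * c\<^sup>2 = k\<^sup>2"
      using dilation_exponent(1)[OF \<kappa> p] dilation_exponent(2)[OF \<kappa> p, of ?d] by (auto simp: c_def k_def l_def)
    have e2: "\<kappa> powr (1 - ?d * ((p - 2) / (2 * p))) * l\<^sup>2 = \<kappa> * k\<^sup>2"
    proof -
      have "\<kappa> * k\<^sup>2 = \<kappa> powr (1 - ?d * ((p - 2) / (2 * p))) * l\<^sup>2 * (\<kappa> * c\<^sup>2)"
        by (simp only: e(2)[symmetric] ac_simps)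
      then show ?thesis by (simp add: e(1))
    qed
    have "?C * \<kappa> powr (1 - ?d * ((p - 2) / (2 * p))) * P\<^sup>2
        = (\<kappa> powr (1 - ?d * ((p - 2) / (2 * p))) * l\<^sup>2) * (?C * P'\<^sup>2)"
      by (simp add: P'(2) power_mult_distrib)
    also have "\<dots> = \<kappa> * k\<^sup>2 * (?C * P'\<^sup>2)" by (simp only: e2)
    also have "\<dots> \<le> \<kappa> * k\<^sup>2 * ((c * a)\<^sup>2 + b\<^sup>2)"
      using C(2)[OF P'(1)] \<kappa> by (intro mult_left_mono) auto
    also have "\<dots> = (\<kappa> * c\<^sup>2) * (k * a)\<^sup>2 + \<kappa> * N\<^sup>2"
      by (simp add: b(2) power_mult_distrib algebra_simps)
    also have "\<dots> \<le> G\<^sup>2 + \<kappa> * N\<^sup>2"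
      using a k by (simp add: e(1) power_mono)
    finally show ?thesis .
  qed
qed

text \<open>The real-number core for a single function, with \<open>G\<close>, \<open>N\<close>,
  \<open>P\<close> standing for the three norms. Keeping \<kappa> free in \<open>gn\<close> allows a
  different choice in each regime.\<close>

lemma mu_interp_bound:
  fixes d p \<Lambda> \<alpha> C P G N :: real
  assumes \<theta>: "d * ((p - 2) / (2 * p)) = \<theta>" "0 < \<theta>" "\<theta> < 1" and p: "0 < p" and \<Lambda>: "0 < \<Lambda>" "- \<Lambda> < \<alpha>"
    and spec: "\<Lambda> * N\<^sup>2 \<le> G\<^sup>2"
    and gn: "\<And>\<kappa>. 0 < \<kappa> \<Longrightarrow> C * \<kappa> powr (1 - \<theta>) * P\<^sup>2 \<le> G\<^sup>2 + \<kappa> * N\<^sup>2"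
  shows "(if \<alpha> \<le> \<Lambda> * (2 * p - d * (p - 2)) / (d * (p - 2))
     then 1 / (2 * p) * (2 * p - d * (p - 2)) powr (1 - \<theta>) * (d * (p - 2)) powr (d * (p - 2) / (2 * p)) * C
            * (\<alpha> + \<Lambda>) * \<Lambda> powr (- \<theta>)
     else C * \<alpha> powr (1 - \<theta>)) * P\<^sup>2 \<le> G\<^sup>2 + \<alpha> * N\<^sup>2"
proof -
  have dp: "d * (p - 2) = 2 * p * \<theta>" "2 * p - d * (p - 2) = 2 * p * (1 - \<theta>)"
    using \<theta>(1) p by (auto simp: field_simps)
  \<comment> \<open>The stationary point of
    \<open>\<kappa> powr (1 - \<theta>) / (\<kappa> + \<Lambda>)\<close>, that is, the solution of
    \<open>(1 - \<theta>) (\<kappa> + \<Lambda>) = \<kappa>\<close>.\<close>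
  define \<kappa> where "\<kappa> = \<Lambda> * (1 - \<theta>) / \<theta>"
  have thr: "\<Lambda> * (2 * p - d * (p - 2)) / (d * (p - 2)) = \<kappa>"
    unfolding dp \<kappa>_def using p \<theta> by (simp add: field_simps)
  have \<kappa>: "0 < \<kappa>" using \<Lambda> \<theta> by (simp add: \<kappa>_def)
  show ?thesis
  proof (cases "\<alpha> \<le> \<kappa>")
    case False
    then show ?thesis using gn[of \<alpha>] \<kappa> thr by simp
  next
    case True
    \<comment> \<open>The weight solving \<open>s \<kappa> - (1 - s) \<Lambda> = \<alpha>\<close>;
      since \<open>\<kappa> + \<Lambda> = \<Lambda> / \<theta>\<close>, it is
      \<open>(\<alpha> + \<Lambda>) / (\<kappa> + \<Lambda>)\<close>. The bound
      \<open>s \<le> 1\<close> is the regime condition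
      \<open>\<alpha> \<le> \<kappa>\<close>.\<close>
    define s where "s = \<theta> * (\<alpha> + \<Lambda>) / \<Lambda>"
    have s: "0 \<le> s" "s \<le> 1"
      using True \<Lambda> \<theta>(2,3) by (simp add: s_def) (use True \<Lambda> \<theta>(2,3) in \<open>simp add: s_def \<kappa>_def field_simps\<close>)
    have \<alpha>: "\<alpha> = s * \<kappa> - (1 - s) * \<Lambda>"
      using \<Lambda> \<theta>(2,3) by (simp add: s_def \<kappa>_def field_simps)
    \<comment> \<open>The ratio of \<open>S_const\<close> to \<open>C_const\<close> in terms of
      \<theta>: the two powers of \<open>2 * p\<close> have exponents adding up to 1 and cancel the
      prefactor.\<close>
    have "1 / (2 * p) * (2 * p - d * (p - 2)) powr (1 - \<theta>) * (d * (p - 2)) powr (d * (p - 2) / (2 * p))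
        = (1 - \<theta>) powr (1 - \<theta>) * \<theta> powr \<theta>"
    proof -
      have e1: "d * (p - 2) / (2 * p) = \<theta>" using \<theta>(1) by simp
      have e2: "(2 * p) powr (1 - \<theta>) * (2 * p) powr \<theta> = 2 * p"
        using p by (simp flip: powr_add)
      have e3: "(2 * p * (1 - \<theta>)) powr (1 - \<theta>) = (2 * p) powr (1 - \<theta>) * (1 - \<theta>) powr (1 - \<theta>)"
        "(2 * p * \<theta>) powr \<theta> = (2 * p) powr \<theta> * \<theta> powr \<theta>"
        using \<theta>(2,3) p by (simp_all add: powr_mult)
      have "1 / (2 * p) * (2 * p - d * (p - 2)) powr (1 - \<theta>) * (d * (p - 2)) powr (d * (p - 2) / (2 * p))
          = 1 / (2 * p) * ((2 * p) powr (1 - \<theta>) * (2 * p) powr \<theta>) * ((1 - \<theta>) powr (1 - \<theta>) * \<theta> powr \<theta>)"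
        unfolding e1 dp(2) unfolding dp(1) e3 by (simp only: ac_simps)
      also have "\<dots> = 1 / (2 * p) * (2 * p) * ((1 - \<theta>) powr (1 - \<theta>) * \<theta> powr \<theta>)"
        by (simp only: e2)
      finally show ?thesis using p by simp
    qed
    then have "1 / (2 * p) * (2 * p - d * (p - 2)) powr (1 - \<theta>) * (d * (p - 2)) powr (d * (p - 2) / (2 * p)) * C
            * (\<alpha> + \<Lambda>) * \<Lambda> powr (- \<theta>)
        = (1 - \<theta>) powr (1 - \<theta>) * \<theta> powr \<theta> * C * (\<alpha> + \<Lambda>) * \<Lambda> powr (- \<theta>)" by (simp only:)
    also have "\<dots> = s * (C * \<kappa> powr (1 - \<theta>))"
    proof -
      have "\<kappa> powr (1 - \<theta>) = \<Lambda> powr (1 - \<theta>) * (1 - \<theta>) powr (1 - \<theta>) / \<theta> powr (1 - \<theta>)"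
        using \<Lambda> \<theta> by (simp add: \<kappa>_def powr_mult powr_divide)
      moreover have "\<Lambda> powr (1 - \<theta>) = \<Lambda> * \<Lambda> powr (- \<theta>)" "\<theta> / \<theta> powr (1 - \<theta>) = \<theta> powr \<theta>"
        using \<Lambda> \<theta> by (simp_all add: powr_diff powr_minus_divide)
      ultimately have "s * (C * \<kappa> powr (1 - \<theta>))
          = (s * \<Lambda>) * C * \<Lambda> powr (- \<theta>) * (1 - \<theta>) powr (1 - \<theta>) / \<theta> powr (1 - \<theta>)"
        by simp
      also have "s * \<Lambda> = \<theta> * (\<alpha> + \<Lambda>)" using \<Lambda> by (simp add: s_def)
      also have "\<theta> * (\<alpha> + \<Lambda>) * C * \<Lambda> powr (- \<theta>) * (1 - \<theta>) powr (1 - \<theta>) / \<theta> powr (1 - \<theta>)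
          = (1 - \<theta>) powr (1 - \<theta>) * (\<theta> / \<theta> powr (1 - \<theta>)) * C * (\<alpha> + \<Lambda>) * \<Lambda> powr (- \<theta>)"
        by simp
      finally show ?thesis using \<open>\<theta> / \<theta> powr (1 - \<theta>) = \<theta> powr \<theta>\<close> by (simp only:)
    qed
    also have "\<dots> * P\<^sup>2 = s * (C * \<kappa> powr (1 - \<theta>) * P\<^sup>2)" by simp
    also have "\<dots> \<le> s * (G\<^sup>2 + \<kappa> * N\<^sup>2)" using gn[OF \<kappa>] s by (intro mult_left_mono)
    also have "\<dots> \<le> s * (G\<^sup>2 + \<kappa> * N\<^sup>2) + (1 - s) * (G\<^sup>2 - \<Lambda> * N\<^sup>2)" using spec s by simp
    also have "\<dots> = G\<^sup>2 + (s * \<kappa> - (1 - s) * \<Lambda>) * N\<^sup>2" by (simp add: algebra_simps)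
    also have "\<dots> = G\<^sup>2 + \<alpha> * N\<^sup>2" by (simp only: \<alpha>[symmetric])
    finally show ?thesis using True thr by simp
  qed
qed

theorem proposition3p1:
  fixes A :: "real^'n \<Rightarrow> real^'n" and \<Lambda> p \<alpha> :: real
  assumes "CARD('n) \<in> {2, 3}"
    and "A \<in> Lq_loc 2"
    and "\<Lambda> > 0"
    and "\<forall>\<psi>\<in>H1_mag A. (Lnorm 2 (mag_grad A \<psi>))\<^sup>2 \<ge> ereal \<Lambda> * (Lnorm 2 \<psi>)\<^sup>2"
    and "\<exists>\<psi>\<in>H1_mag A. \<not> ae_zero \<psi> \<and>
           (Lnorm 2 (mag_grad A \<psi>))\<^sup>2 = ereal \<Lambda> * (Lnorm 2 \<psi>)\<^sup>2"
    and "2 < p" and "ereal p < two_star CARD('n)"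
    and "\<alpha> > - \<Lambda>"
  shows "mu_mag A p \<alpha> \<ge> mu_interp TYPE('n) p \<Lambda> \<alpha>"
proof -
  let ?d = "real CARD('n)" and ?C = "C_const TYPE('n) p"
  define \<theta> where "\<theta> = ?d * ((p - 2) / (2 * p))"
  have p: "0 < p" using assms(6) by simp
  \<comment> \<open>Subcriticality: for \<open>d = 2\<close>, \<open>\<theta> = 1 - 2 / p\<close>;
    for \<open>d = 3\<close>, \<open>\<theta> < 1\<close> amounts to \<open>p < 6\<close>.\<close>
  have \<theta>: "0 < \<theta>" "\<theta> < 1"
    using assms(1,6,7) by (auto simp: \<theta>_def two_star_def field_simps)
  define adm where "adm = (\<lambda>\<mu>. \<forall>\<psi>\<in>H1_mag A.
     (Lnorm 2 (mag_grad A \<psi>))\<^sup>2 + ereal \<alpha> * (Lnorm 2 \<psi>)\<^sup>2 \<ge> ereal \<mu> * (Lnorm p \<psi>)\<^sup>2)"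
  have mu: "mu_mag A p \<alpha> = Greatest adm" by (simp add: mu_mag_def adm_def)
  define H where "H = {\<psi> \<in> H1_mag A. \<not> ae_zero \<psi>}"
  define E where "E = (\<lambda>\<psi>. (real_of_ereal (Lnorm 2 (mag_grad A \<psi>)))\<^sup>2 + \<alpha> * (real_of_ereal (Lnorm 2 \<psi>))\<^sup>2)"
  \<comment> \<open>The energy is finite on the magnetic Sobolev space, and the spectral bound with
    \<open>\<alpha> > - \<Lambda>\<close> makes it nonnegative; this will bound the quotients from
    below.\<close>
  have E: "(Lnorm 2 (mag_grad A \<psi>))\<^sup>2 + ereal \<alpha> * (Lnorm 2 \<psi>)\<^sup>2 = ereal (E \<psi>)" "0 \<le> E \<psi>" if \<psi>: "\<psi> \<in> H1_mag A" for \<psi>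
  proof -
    obtain G N where GN: "Lnorm 2 (mag_grad A \<psi>) = ereal G" "Lnorm 2 \<psi> = ereal N"
      using H1_mag_E[OF \<psi>] by metis
    then show "(Lnorm 2 (mag_grad A \<psi>))\<^sup>2 + ereal \<alpha> * (Lnorm 2 \<psi>)\<^sup>2 = ereal (E \<psi>)" by (simp add: E_def)
    have "\<Lambda> * N\<^sup>2 \<le> G\<^sup>2" using assms(4) \<psi> GN by fastforce
    moreover have "- \<Lambda> * N\<^sup>2 \<le> \<alpha> * N\<^sup>2" using assms(8) by (intro mult_right_mono) auto
    ultimately show "0 \<le> E \<psi>" using GN by (simp add: E_def)
  qed
  have zero: "Lnorm p \<psi> = 0 \<longleftrightarrow> ae_zero \<psi>" if "\<psi> \<in> H1_mag A" for \<psi>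
    using that p by (intro Lnorm_eq_0_iff) (auto simp: H1_mag_def Lq_def)
  \<comment> \<open>A null function has p-norm 0 and nonnegative energy, so it does not constrain
    \<open>\<mu>\<close>.\<close>
  have adm_iff: "adm \<mu> \<longleftrightarrow> (\<forall>\<psi>\<in>H. ereal \<mu> * (Lnorm p \<psi>)\<^sup>2 \<le> ereal (E \<psi>))" for \<mu>
  proof -
    have "ereal \<mu> * (Lnorm p \<psi>)\<^sup>2 \<le> ereal (E \<psi>)" if "\<psi> \<in> H1_mag A" "ae_zero \<psi>" for \<psi>
      using E(2)[OF that(1)] zero[OF that(1)] that(2) by (simp add: power2_eq_square)
    then show ?thesis using E(1) by (auto simp: adm_def H_def)
  qed
  \<comment> \<open>A nonzero competitor makes the infimum below range over a nonempty set; over an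
    empty one every \<open>\<mu>\<close> would be admissible.\<close>
  obtain \<psi>0 where \<psi>0: "\<psi>0 \<in> H" using assms(5) by (auto simp: H_def)
  \<comment> \<open>A function with infinite \<open>p\<close>-norm makes both sides zero, so no Sobolev embedding is needed.\<close>
  show ?thesis
  proof (cases "\<exists>\<psi>\<in>H. Lnorm p \<psi> = \<infinity>")
    case True
    then obtain \<psi> where \<psi>: "\<psi> \<in> H" "Lnorm p \<psi> = \<infinity>" by blast
    obtain G N where GN: "Lnorm 2 (mag_grad A \<psi>) = ereal G" "Lnorm 2 \<psi> = ereal N"
      using H1_mag_E[of \<psi> A] \<psi>(1) unfolding H_def by blast
    have "?C = 0"
      using magnetic_gagliardo_nirenberg(1)[OF _ _ p zero_less_one GN \<psi>(2)] \<psi>(1) by (auto simp: H_def)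
    then have "mu_interp TYPE('n) p \<Lambda> \<alpha> = 0" by (simp add: mu_interp_def S_const_def Let_def)
    \<comment> \<open>A positive \<open>\<mu>\<close> would make the left side infinite at this
      function, whose energy is finite; 0 is admissible because energies are nonnegative.\<close>
    moreover have "Greatest adm = 0"
    proof (rule Greatest_equality)
      show "adm 0" using E(2) by (auto simp: adm_iff H_def simp flip: zero_ereal_def)
      fix \<mu> assume "adm \<mu>"
      then have "ereal \<mu> * \<infinity> \<le> ereal (E \<psi>)" using \<psi> by (force simp: adm_iff power2_eq_square)
      then show "\<mu> \<le> 0" by (cases "\<mu> > 0") auto
    qed
    ultimately show ?thesis by (simp add: mu)
  next
    case False
    define Q where "Q = (\<lambda>\<psi>. E \<psi> / (real_of_ereal (Lnorm p \<psi>))\<^sup>2)"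
    have fin: "\<exists>P>0. Lnorm p \<psi> = ereal P" if "\<psi> \<in> H" for \<psi>
      using that False zero[of \<psi>] Lnorm_nonneg[of p \<psi>] unfolding H_def by (cases "Lnorm p \<psi>") auto
    have adm_Q: "adm \<mu> \<longleftrightarrow> (\<forall>\<psi>\<in>H. \<mu> \<le> Q \<psi>)" for \<mu>
      unfolding adm_iff
    proof (intro ball_cong refl)
      fix \<psi> assume "\<psi> \<in> H"
      from fin[OF this] obtain P where "P > 0" "Lnorm p \<psi> = ereal P" by blast
      then show "ereal \<mu> * (Lnorm p \<psi>)\<^sup>2 \<le> ereal (E \<psi>) \<longleftrightarrow> \<mu> \<le> Q \<psi>"
        by (simp add: Q_def pos_le_divide_eq)
    qed
    have bdd: "bdd_below (Q ` H)"
      using E(2) by (intro bdd_belowI[of _ 0]) (auto simp: Q_def H_def)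
    \<comment> \<open>Being admissible means being a lower bound of the real quotients
      \<open>Q\<close>, so the greatest admissible constant is their infimum, whether or not a
      minimiser exists.\<close>
    have greatest: "Greatest adm = (INF \<psi>\<in>H. Q \<psi>)"
    proof (rule Greatest_equality)
      show "adm (INF \<psi>\<in>H. Q \<psi>)" unfolding adm_Q using bdd by (auto intro: cINF_lower)
      show "\<mu> \<le> (INF \<psi>\<in>H. Q \<psi>)" if "adm \<mu>" for \<mu>
        using that \<psi>0 unfolding adm_Q by (intro cINF_greatest) auto
    qed
    have "adm (mu_interp TYPE('n) p \<Lambda> \<alpha>)"
      unfolding adm_iff
    proof
      fix \<psi> assume \<psi>: "\<psi> \<in> H"
      then have \<psi>': "\<psi> \<in> H1_mag A" "\<not> ae_zero \<psi>" by (auto simp: H_def)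
      obtain P where P: "Lnorm p \<psi> = ereal P" using fin[OF \<psi>] by blast
      obtain G N where GN: "Lnorm 2 (mag_grad A \<psi>) = ereal G" "Lnorm 2 \<psi> = ereal N"
        using H1_mag_E[OF \<psi>'(1)] by metis
      have "\<Lambda> * N\<^sup>2 \<le> G\<^sup>2" using assms(4) \<psi>'(1) GN by fastforce
      from mu_interp_bound[OF \<theta>_def[symmetric] \<theta> p assms(3,8) this,
          OF magnetic_gagliardo_nirenberg(2)[OF \<psi>' p _ GN P, folded \<theta>_def]]
      have "mu_interp TYPE('n) p \<Lambda> \<alpha> * P\<^sup>2 \<le> G\<^sup>2 + \<alpha> * N\<^sup>2"
        unfolding mu_interp_def S_const_def Let_def \<theta>_def[symmetric] .
      then show "ereal (mu_interp TYPE('n) p \<Lambda> \<alpha>) * (Lnorm p \<psi>)\<^sup>2 \<le> ereal (E \<psi>)"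
        by (simp add: P E_def GN)
    qed
    then show ?thesis
      unfolding mu greatest adm_Q using \<psi>0 by (intro cINF_greatest) auto
  qed
qed

end
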